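(* For every integer $d\ge 1$ there is a constant $c>0$ depending only on $d$ such that the following holds for every prime $p$. Let $S'\subset \mathrm{SL}_d(\mathbb{F}_p)$, and let $S\subset \mathbb{F}_p^d\rtimes \mathrm{SL}_d(\mathbb{F}_p)$ be a set such that the map sending an element to its linear part restricts to a bijection from $S$ onto $S'$. Suppose further that $S$ is not contained in a coset of a proper subgroup of $\mathbb{F}_p^d\rtimes \mathrm{SL}_d(\mathbb{F}_p)$. Then $$1-\|\mathcal{L}_0(\mathbb{F}_p^d\rtimes \mathrm{SL}_d(\mathbb{F}_p),S)\|\ \ge\ c\cdot\min\{1-\|\mathcal{L}_0(\mathrm{SL}_d(\mathbb{F}_p),S')\|,\ |S|^{-1}\}.$$
   Context: The group $\mathbb{F}_p^d\rtimes \mathrm{SL}_d(\mathbb{F}_p)$ has product $(v_1,\theta_1)\cdot(v_2,\theta_2)=(v_1+\theta_1v_2,\theta_1\theta_2)$; the linear part of $(v,\theta)$ is $\theta$. For a finite group $G$ and a nonempty subset $S\subset G$, let $\mathcal{L}(G,S)$ be the operator on the space $\mathbb{C}[G]$ of complex-valued functions on $G$ given by $\mathcal{L}(G,S)f(g)=\frac1{|S|}\sum_{s\in S}f(s^{-1}g)$. Let $\mathcal{L}_0(G,S)$ be its restriction to the codimension-one subspace of functions orthogonal to the constants. $\|\cdot\|$ is the operator norm with respect to the $L^2$ norm on $G$ with counting measure (the operator on the zero space has norm $0$). *)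

theory Defs
  imports
    "Jordan_Normal_Form.Determinant"
    "HOL-Algebra.Coset"
    "HOL-Analysis.L2_Norm"
    "HOL-Computational_Algebra.Primes"
begin

text \<open>
  The prime field of order p depends on the bound variable p and hence cannot be a type.
  As in the residue rings of HOL-Algebra, its elements are represented by the integers in
  the interval from 0 to p - 1 with arithmetic modulo p.  Vectors and matrices over the field
  are integer vectors and matrices with reduced entries; operations are carried out over
  the integers and then reduced entrywise.
\<close>

definition vec_mod :: "nat \<Rightarrow> int vec \<Rightarrow> int vec" where
  "vec_mod p v = map_vec (\<lambda>x. x mod int p) v"

definition mat_mod :: "nat \<Rightarrow> int mat \<Rightarrow> int mat" where
  "mat_mod p A = map_mat (\<lambda>x. x mod int p) A"

definition Fp_vecs :: "nat \<Rightarrow> nat \<Rightarrow> int vec set" where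
  "Fp_vecs d p = {v \<in> carrier_vec d. \<forall>i<d. v $ i \<in> {0..<int p}}"

definition Fp_mats :: "nat \<Rightarrow> nat \<Rightarrow> int mat set" where
  "Fp_mats d p = {A \<in> carrier_mat d d. \<forall>i<d. \<forall>j<d. A $$ (i, j) \<in> {0..<int p}}"

definition special_linear :: "nat \<Rightarrow> nat \<Rightarrow> int mat monoid" where
  "special_linear d p =
     \<lparr>carrier = {A \<in> Fp_mats d p. det A mod int p = 1 mod int p},
      mult = (\<lambda>A B. mat_mod p (A * B)),
      one = 1\<^sub>m d\<rparr>"

text \<open>The semidirect product; the linear part of an element is its second component.\<close>

definition affine_special_linear :: "nat \<Rightarrow> nat \<Rightarrow> (int vec \<times> int mat) monoid" where
  "affine_special_linear d p =
     \<lparr>carrier = Fp_vecs d p \<times> carrier (special_linear d p),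
      mult = (\<lambda>(v, A) (w, B). (vec_mod p (v + A *\<^sub>v w), A \<otimes>\<^bsub>special_linear d p\<^esub> B)),
      one = (0\<^sub>v d, \<one>\<^bsub>special_linear d p\<^esub>)\<rparr>"

text \<open>Left cosets suffice: the right coset of H by g is the left coset by g of a conjugate of H.\<close>

definition in_proper_coset :: "('a, 'b) monoid_scheme \<Rightarrow> 'a set \<Rightarrow> bool" where
  "in_proper_coset G S \<longleftrightarrow>
     (\<exists>H g. subgroup H G \<and> H \<noteq> carrier G \<and> g \<in> carrier G \<and> S \<subseteq> g <#\<^bsub>G\<^esub> H)"

text \<open>
  Complex-valued functions on a finite group G are the elements of
  \<open>extensional (carrier G)\<close>, so that the operators below act on a vector space of
  dimension \<open>card (carrier G)\<close>, up to the default value outside the carrier.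
\<close>

definition l2_inner ::
    "('a, 'b) monoid_scheme \<Rightarrow> ('a \<Rightarrow> complex) \<Rightarrow> ('a \<Rightarrow> complex) \<Rightarrow> complex" where
  "l2_inner G f h = (\<Sum>g\<in>carrier G. f g * cnj (h g))"

definition l2_norm :: "('a, 'b) monoid_scheme \<Rightarrow> ('a \<Rightarrow> complex) \<Rightarrow> real" where
  "l2_norm G f = L2_set (\<lambda>g. norm (f g)) (carrier G)"

definition orthogonal_to_constants :: "('a, 'b) monoid_scheme \<Rightarrow> ('a \<Rightarrow> complex) set" where
  "orthogonal_to_constants G =
     {f \<in> extensional (carrier G). \<forall>c. l2_inner G f (\<lambda>g. c) = 0}"

definition avg_op ::
    "('a, 'b) monoid_scheme \<Rightarrow> 'a set \<Rightarrow> ('a \<Rightarrow> complex) \<Rightarrow> ('a \<Rightarrow> complex)" where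
  "avg_op G S f =
     (\<lambda>g\<in>carrier G. 1 / of_nat (card S) * (\<Sum>s\<in>S. f (inv\<^bsub>G\<^esub> s \<otimes>\<^bsub>G\<^esub> g)))"

text \<open>
  The operator norm of the restriction of T to the subspace V.  The set below contains 0 and,
  for finite G and linear T, is bounded; on the zero space the supremum is 0.
\<close>

definition op_norm_on ::
    "('a, 'b) monoid_scheme \<Rightarrow> ('a \<Rightarrow> complex) set \<Rightarrow>
     (('a \<Rightarrow> complex) \<Rightarrow> ('a \<Rightarrow> complex)) \<Rightarrow> real" where
  "op_norm_on G V T = Sup {l2_norm G (T f) | f. f \<in> V \<and> l2_norm G f \<le> 1}"

definition avg_op0_norm :: "('a, 'b) monoid_scheme \<Rightarrow> 'a set \<Rightarrow> real" where
  "avg_op0_norm G S = op_norm_on G (orthogonal_to_constants G) (avg_op G S)"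

lemma mod_dims [simp]:
  "dim_vec (vec_mod p v) = dim_vec v"
  "dim_row (mat_mod p A) = dim_row A" "dim_col (mat_mod p A) = dim_col A"
  "vec_mod p v \<in> carrier_vec n \<longleftrightarrow> v \<in> carrier_vec n"
  "mat_mod p A \<in> carrier_mat n m \<longleftrightarrow> A \<in> carrier_mat n m"
  by (simp_all add: vec_mod_def mat_mod_def)

lemma sum_mult_mod_left:
  "(\<Sum>i\<in>I. (f i mod m) * g i) mod m = (\<Sum>i\<in>I. f i * g i) mod (m :: int)"
  using mod_sum_eq [of "\<lambda>i. (f i mod m) * g i" m I] mod_sum_eq [of "\<lambda>i. f i * g i" m I]
  by (simp only: mod_mult_left_eq)

lemma sum_mult_mod_right:
  "(\<Sum>i\<in>I. f i * (g i mod m)) mod m = (\<Sum>i\<in>I. f i * g i) mod (m :: int)"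
  using mod_sum_eq [of "\<lambda>i. f i * (g i mod m)" m I] mod_sum_eq [of "\<lambda>i. f i * g i" m I]
  by (simp only: mod_mult_right_eq)

lemma mat_mod_mult_left:
  assumes "A \<in> carrier_mat n m" "B \<in> carrier_mat m k"
  shows "mat_mod p (mat_mod p A * B) = mat_mod p (A * B)"
  using assms by (intro eq_matI) (auto simp: mat_mod_def scalar_prod_def sum_mult_mod_left)

lemma mat_mod_mult_right:
  assumes "A \<in> carrier_mat n m" "B \<in> carrier_mat m k"
  shows "mat_mod p (A * mat_mod p B) = mat_mod p (A * B)"
  using assms by (intro eq_matI) (auto simp: mat_mod_def scalar_prod_def sum_mult_mod_right)

lemma vec_mod_mult_left:
  assumes "A \<in> carrier_mat n m" "v \<in> carrier_vec m"
  shows "vec_mod p (mat_mod p A *\<^sub>v v) = vec_mod p (A *\<^sub>v v)"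
  using assms by (intro eq_vecI) (auto simp: mat_mod_def vec_mod_def scalar_prod_def sum_mult_mod_left)

lemma vec_mod_mult_right:
  assumes "A \<in> carrier_mat n m" "v \<in> carrier_vec m"
  shows "vec_mod p (A *\<^sub>v vec_mod p v) = vec_mod p (A *\<^sub>v v)"
  using assms by (intro eq_vecI) (auto simp: vec_mod_def scalar_prod_def sum_mult_mod_right)

lemma vec_mod_add_left:
  "v \<in> carrier_vec n \<Longrightarrow> w \<in> carrier_vec n \<Longrightarrow> vec_mod p (vec_mod p v + w) = vec_mod p (v + w)"
  by (intro eq_vecI) (auto simp: vec_mod_def mod_add_left_eq)

lemma vec_mod_add_right:
  "v \<in> carrier_vec n \<Longrightarrow> w \<in> carrier_vec n \<Longrightarrow> vec_mod p (v + vec_mod p w) = vec_mod p (v + w)"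
  by (intro eq_vecI) (auto simp: vec_mod_def mod_add_right_eq)

lemma det_mat_mod:
  assumes "A \<in> carrier_mat n n"
  shows "det (mat_mod p A) mod int p = det A mod int p"
proof -
  have "(signof q * (\<Prod>i=0..<n. mat_mod p A $$ (i, q i))) mod int p =
        (signof q * (\<Prod>i=0..<n. A $$ (i, q i))) mod int p" if "q permutes {0..<n}" for q
  proof -
    have "(\<Prod>i=0..<n. mat_mod p A $$ (i, q i)) = (\<Prod>i=0..<n. A $$ (i, q i) mod int p)"
      using assms permutes_in_image [OF that] by (intro prod.cong) (auto simp: mat_mod_def)
    hence "(\<Prod>i=0..<n. mat_mod p A $$ (i, q i)) mod int p = (\<Prod>i=0..<n. A $$ (i, q i)) mod int p"
      by (simp add: mod_prod_eq)
    thus ?thesis by (rule mod_mult_cong [OF refl])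
  qed
  hence "(\<Sum>q | q permutes {0..<n}. (signof q * (\<Prod>i=0..<n. mat_mod p A $$ (i, q i))) mod int p) mod int p =
         (\<Sum>q | q permutes {0..<n}. (signof q * (\<Prod>i=0..<n. A $$ (i, q i))) mod int p) mod int p"
    by (intro arg_cong [where f = "\<lambda>x. x mod int p"], rule sum.cong [OF refl])
      (simp only: mem_Collect_eq)
  moreover have "mat_mod p A \<in> carrier_mat n n" using assms by simp
  ultimately show ?thesis
    unfolding det_def' [OF assms] det_def' [OF \<open>mat_mod p A \<in> carrier_mat n n\<close>] mod_sum_eq by blast
qed

lemma mat_mod_in_Fp_mats: "p > 0 \<Longrightarrow> A \<in> carrier_mat d d \<Longrightarrow> mat_mod p A \<in> Fp_mats d p"
  by (auto simp: Fp_mats_def) (auto simp: mat_mod_def)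

lemma vec_mod_in_Fp_vecs: "p > 0 \<Longrightarrow> v \<in> carrier_vec d \<Longrightarrow> vec_mod p v \<in> Fp_vecs d p"
  by (auto simp: Fp_vecs_def) (auto simp: vec_mod_def)

lemma mat_mod_id: "A \<in> Fp_mats d p \<Longrightarrow> mat_mod p A = A"
  by (intro eq_matI) (auto simp: Fp_mats_def mat_mod_def)

lemma vec_mod_id: "v \<in> Fp_vecs d p \<Longrightarrow> vec_mod p v = v"
  by (intro eq_vecI) (auto simp: Fp_vecs_def vec_mod_def)

lemma Fp_mats_carrier: "A \<in> Fp_mats d p \<Longrightarrow> A \<in> carrier_mat d d"
  by (simp add: Fp_mats_def)

lemma Fp_vecs_carrier: "v \<in> Fp_vecs d p \<Longrightarrow> v \<in> carrier_vec d"
  by (simp add: Fp_vecs_def)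

lemma group_special_linear:
  assumes "prime p"
  shows "group (special_linear d p)"
proof (rule groupI)
  have p: "p > 1" using assms by (rule prime_gt_1_nat)
  fix A B assume "A \<in> carrier (special_linear d p)" "B \<in> carrier (special_linear d p)"
  hence A: "A \<in> carrier_mat d d" "det A mod int p = 1" and B: "B \<in> carrier_mat d d" "det B mod int p = 1"
    using p by (auto simp: special_linear_def Fp_mats_def)
  have "det (A * B) mod int p = 1"
    using p mod_mult_eq [of "det A" "int p" "det B"] by (simp add: det_mult [OF A(1) B(1)] A(2) B(2))
  thus "A \<otimes>\<^bsub>special_linear d p\<^esub> B \<in> carrier (special_linear d p)"
    using A B p by (simp add: special_linear_def mat_mod_in_Fp_mats det_mat_mod [of _ d])
next
  have "p > 1" using assms by (rule prime_gt_1_nat)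
  thus "\<one>\<^bsub>special_linear d p\<^esub> \<in> carrier (special_linear d p)"
    by (auto simp: special_linear_def Fp_mats_def)
next
  fix A B C
  assume "A \<in> carrier (special_linear d p)" "B \<in> carrier (special_linear d p)"
    "C \<in> carrier (special_linear d p)"
  hence c: "A \<in> carrier_mat d d" "B \<in> carrier_mat d d" "C \<in> carrier_mat d d"
    by (auto simp: special_linear_def Fp_mats_def)
  show "A \<otimes>\<^bsub>special_linear d p\<^esub> B \<otimes>\<^bsub>special_linear d p\<^esub> C =
        A \<otimes>\<^bsub>special_linear d p\<^esub> (B \<otimes>\<^bsub>special_linear d p\<^esub> C)"
    using c by (simp add: special_linear_def mat_mod_mult_left [of _ d d _ d]
        mat_mod_mult_right [of _ d d _ d] assoc_mult_mat [of _ d d _ d _ d])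
next
  fix A assume "A \<in> carrier (special_linear d p)"
  thus "\<one>\<^bsub>special_linear d p\<^esub> \<otimes>\<^bsub>special_linear d p\<^esub> A = A"
    by (auto simp: special_linear_def mat_mod_id left_mult_one_mat [OF Fp_mats_carrier])
next
  have p: "p > 1" using assms by (rule prime_gt_1_nat)
  fix A assume "A \<in> carrier (special_linear d p)"
  hence A: "A \<in> carrier_mat d d" "det A mod int p = 1"
    using p by (auto simp: special_linear_def Fp_mats_def)
  let ?B = "mat_mod p (adj_mat A)"
  have B: "adj_mat A \<in> carrier_mat d d" by (rule adj_mat [OF A(1)])
  have "mat_mod p (adj_mat A * A) = 1\<^sub>m d"
    using A(2) p by (intro eq_matI) (auto simp: adj_mat [OF A(1)] mat_mod_def)
  hence inv: "mat_mod p (?B * A) = 1\<^sub>m d"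
    using mat_mod_mult_left [OF B A(1)] by simp
  have "det (mat_mod p (?B * A)) mod int p = det ?B * det A mod int p"
    using A B det_mat_mod [of "?B * A" d p] det_mult [of ?B d A] by simp
  hence "det ?B mod int p = 1"
    using inv p A(2) mod_mult_right_eq [of "det ?B" "det A" "int p"] by simp
  thus "\<exists>B\<in>carrier (special_linear d p). B \<otimes>\<^bsub>special_linear d p\<^esub> A = \<one>\<^bsub>special_linear d p\<^esub>"
    using inv B p by (intro bexI [of _ ?B]) (auto simp: special_linear_def mat_mod_in_Fp_mats)
qed

lemma group_affine_special_linear:
  assumes "prime p"
  shows "group (affine_special_linear d p)"
proof -
  interpret SL: group "special_linear d p" using assms by (rule group_special_linear)
  have p: "p > 0" using assms by (rule prime_gt_0_nat)
  have SLc: "A \<in> carrier_mat d d" if "A \<in> carrier (special_linear d p)" for A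
    using that by (auto simp: special_linear_def Fp_mats_def)
  have SLm: "A \<otimes>\<^bsub>special_linear d p\<^esub> B = mat_mod p (A * B)" for A B
    by (simp add: special_linear_def)
  have SL1: "\<one>\<^bsub>special_linear d p\<^esub> = 1\<^sub>m d"
    by (simp add: special_linear_def)
  let ?G = "affine_special_linear d p"
  have mem: "(v, A) \<in> carrier ?G \<longleftrightarrow> v \<in> Fp_vecs d p \<and> A \<in> carrier (special_linear d p)" for v A
    by (simp add: affine_special_linear_def)
  have mul: "(v, A) \<otimes>\<^bsub>?G\<^esub> (w, B) = (vec_mod p (v + A *\<^sub>v w), A \<otimes>\<^bsub>special_linear d p\<^esub> B)" for v A w B
    by (simp add: affine_special_linear_def)
  have one: "\<one>\<^bsub>?G\<^esub> = (0\<^sub>v d, \<one>\<^bsub>special_linear d p\<^esub>)"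
    by (simp add: affine_special_linear_def)
  show ?thesis
  proof (rule groupI)
    fix x y assume "x \<in> carrier ?G" "y \<in> carrier ?G"
    then show "x \<otimes>\<^bsub>?G\<^esub> y \<in> carrier ?G"
      by (cases x, cases y)
        (auto simp: mem mul intro!: vec_mod_in_Fp_vecs p add_carrier_vec mult_mat_vec_carrier
          dest: SLc Fp_vecs_carrier)
  next
    show "\<one>\<^bsub>?G\<^esub> \<in> carrier ?G" using p by (auto simp: one mem Fp_vecs_def)
  next
    fix x y z assume "x \<in> carrier ?G" "y \<in> carrier ?G" "z \<in> carrier ?G"
    then obtain u A v B w C where x: "x = (u, A)" and y: "y = (v, B)" and z: "z = (w, C)"
      and SL: "A \<in> carrier (special_linear d p)" "B \<in> carrier (special_linear d p)"
        "C \<in> carrier (special_linear d p)"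
      and V: "u \<in> carrier_vec d" "v \<in> carrier_vec d" "w \<in> carrier_vec d"
      by (cases x, cases y, cases z) (auto simp: mem Fp_vecs_carrier)
    note M = SL [THEN SLc]
    have "vec_mod p (vec_mod p (u + A *\<^sub>v v) + mat_mod p (A * B) *\<^sub>v w) =
          vec_mod p (vec_mod p (u + A *\<^sub>v v) + vec_mod p (mat_mod p (A * B) *\<^sub>v w))"
      using M V by (subst vec_mod_add_right [of _ d]) (auto intro!: mult_mat_vec_carrier)
    also have "vec_mod p (mat_mod p (A * B) *\<^sub>v w) = vec_mod p ((A * B) *\<^sub>v w)"
      using M V by (intro vec_mod_mult_left [of _ d d]) auto
    also have "vec_mod p (vec_mod p (u + A *\<^sub>v v) + vec_mod p ((A * B) *\<^sub>v w)) =
          vec_mod p ((u + A *\<^sub>v v) + (A * B) *\<^sub>v w)"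
      using M V by (simp add: vec_mod_add_right [of _ d] vec_mod_add_left [of _ d])
    also have "(u + A *\<^sub>v v) + (A * B) *\<^sub>v w = u + A *\<^sub>v (v + B *\<^sub>v w)"
      using M V by (simp add: mult_add_distrib_mat_vec [of A d d] assoc_mult_mat_vec [of _ d d _ d]
          assoc_add_vec [of _ d])
    also have "vec_mod p (u + A *\<^sub>v (v + B *\<^sub>v w)) =
          vec_mod p (u + vec_mod p (A *\<^sub>v (v + B *\<^sub>v w)))"
      using M V by (simp add: vec_mod_add_right [of _ d])
    also have "vec_mod p (A *\<^sub>v (v + B *\<^sub>v w)) = vec_mod p (A *\<^sub>v vec_mod p (v + B *\<^sub>v w))"
      using M V by (simp add: vec_mod_mult_right [of _ d d])
    also have "vec_mod p (u + vec_mod p (A *\<^sub>v vec_mod p (v + B *\<^sub>v w))) =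
          vec_mod p (u + A *\<^sub>v vec_mod p (v + B *\<^sub>v w))"
      using M V by (intro vec_mod_add_right [of _ d]) (auto intro!: mult_mat_vec_carrier)
    finally show "x \<otimes>\<^bsub>?G\<^esub> y \<otimes>\<^bsub>?G\<^esub> z = x \<otimes>\<^bsub>?G\<^esub> (y \<otimes>\<^bsub>?G\<^esub> z)"
      unfolding x y z mul using SL by (simp add: SL.m_assoc) (simp add: SLm)
  next
    fix x assume "x \<in> carrier ?G"
    then show "\<one>\<^bsub>?G\<^esub> \<otimes>\<^bsub>?G\<^esub> x = x"
      by (cases x) (auto simp: one mem mul, auto simp: SL1 vec_mod_id Fp_vecs_carrier)
  next
    fix x assume "x \<in> carrier ?G"
    then obtain v A where x: "x = (v, A)" "A \<in> carrier (special_linear d p)" "v \<in> carrier_vec d"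
      by (cases x) (auto simp: mem Fp_vecs_carrier)
    let ?B = "inv\<^bsub>special_linear d p\<^esub> A"
    have B: "?B \<in> carrier (special_linear d p)" using x by simp
    have Bv: "?B *\<^sub>v v \<in> carrier_vec d" using SLc [OF B] x by (auto intro!: mult_mat_vec_carrier)
    have "vec_mod p (vec_mod p (- (?B *\<^sub>v v)) + ?B *\<^sub>v v) = vec_mod p (- (?B *\<^sub>v v) + ?B *\<^sub>v v)"
      using Bv by (simp add: vec_mod_add_left [of _ d])
    also have "\<dots> = 0\<^sub>v d" using Bv by (intro eq_vecI) (auto simp: vec_mod_def)
    finally show "\<exists>y\<in>carrier ?G. y \<otimes>\<^bsub>?G\<^esub> x = \<one>\<^bsub>?G\<^esub>"
      using x B Bv p
      by (intro bexI [of _ "(vec_mod p (- (?B *\<^sub>v v)), ?B)"])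
        (auto simp: mem mul one intro!: vec_mod_in_Fp_vecs)
  qed
qed

end

theory Submission
  imports Defs
begin

text \<open>
  Write \<open>G\<close> for the affine group, \<open>V\<close> for its subgroup of translations and \<open>M\<close> for the order of
  \<open>V\<close>.  Translating a function on \<open>G\<close> from the right by elements of \<open>V\<close> commutes with averaging
  over \<open>S\<close> from the left, so \<open>L\<^sup>2(G)\<close> is the orthogonal sum of averaging-invariant pieces, one for
  each character \<open>\<psi>\<close> of \<open>V\<close>, consisting of the functions with \<open>f(gv) = \<psi>(v) f(g)\<close>
  (\<open>sum_energy_isotypic\<close>).  The piece of the trivial character is \<open>L\<^sup>2(SL\<^sub>d)\<close>, where averaging is
  averaging over the linear parts.  The work lies in a nontrivial character \<open>\<chi>\<close>.

  Let \<open>\<gamma>\<close> be the gap of the linear parts, and suppose that averaging over \<open>S\<close> takes some \<open>f\<close> in the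
  piece of \<open>\<chi>\<close> to a function of norm more than \<open>1 - \<epsilon>\<close> times that of \<open>f\<close>, where
  \<open>\<epsilon> = c min(\<gamma>, 1/|S|)\<close>.  Then the translates of \<open>f\<close> by the elements of \<open>S\<close> differ, in mean
  square, by \<open>O(\<epsilon>)\<close>.  The same holds for \<open>|f|\<close>, which is a function on the quotient by \<open>V\<close>; there
  the gap \<open>\<gamma>\<close> turns it into a variance of \<open>O(\<epsilon>/\<gamma>) = O(c)\<close>, so \<open>|f|\<close> is almost constant.  Projecting
  the values of \<open>f\<close> to the unit disc gives a bounded function \<open>u\<close> that is almost unimodular and whose
  translates still differ by \<open>O(\<epsilon>)\<close>.

  The right translate of \<open>u\<close> by \<open>h\<close> transforms under \<open>V\<close> by the conjugated character \<open>\<chi>\<^sup>h\<close>.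
  Therefore a product \<open>u\<^sub>1 u\<^sub>2 cnj(u\<^sub>3)\<close> of such translates whose characters satisfy
  \<open>\<chi>\<^sub>1 \<chi>\<^sub>2 = \<chi>\<^sub>3\<close> descends to the quotient by \<open>V\<close>, and by the gap it is almost constant and not
  small (\<open>triple_correlation\<close>).  As \<open>G\<close> permutes the nontrivial characters transitively, the trivial
  character can be adjoined so that all \<open>M\<close> characters have the same weight.  Consider the weighted
  correlation of \<open>u\<close> with its left translate by \<open>g\<close>.  Its second moment over \<open>g\<close> is at most
  \<open>1/M\<close>, since different characters are orthogonal, and its third moment is almost \<open>1/M\<close>, by the
  triple products.  A function of modulus at most one with this property is almost one wherever it is
  substantial, and so more than \<open>|G|/(2M)\<close> elements \<open>g\<close> almost fix \<open>u\<close> (\<open>card_near\<close>).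

  A nontrivial translation moves \<open>u\<close> a lot.  Hence the elements that almost fix \<open>u\<close> lie in different
  cosets of \<open>V\<close>, and they meet more than half of these cosets, so the products of two of them meet
  every coset of \<open>V\<close>, and exactly once.  Such products form a subgroup \<open>K\<close>, a complement of \<open>V\<close>
  (\<open>subgroup_stabiliser\<close>).  As \<open>\<epsilon>\<close> is also at most \<open>c/|S|\<close>, every single quotient of two
  elements of \<open>S\<close> almost fixes \<open>u\<close> and lies in \<open>K\<close>; thus \<open>S\<close> lies in a coset of a proper
  subgroup, contrary to the hypothesis.

  This argument uses only that conjugation by \<open>G\<close> is transitive on the nontrivial characters of
  \<open>V\<close>, and gives the constant \<open>c = 10^-8\<close>.  For the affine group with \<open>d \<ge> 2\<close>, transitivity follows
  by transvections.  For \<open>d = 1\<close> the group \<open>SL\<^sub>1\<close> is trivial, so \<open>S\<close> has at most one element and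
  lies in a coset of the trivial subgroup.
\<close>

section \<open>The nearest-point projection onto the unit disc\<close>

text \<open>The normalisation of a complex number to modulus one is discontinuous at zero; this projection
  onto the disc is Lipschitz with constant one and still commutes with rotations.\<close>

definition clip :: "complex \<Rightarrow> complex" where
  "clip z = z / of_real (max 1 (norm z))"

lemma norm_clip: "norm (clip z) = min 1 (norm z)"
  by (auto simp: clip_def norm_divide max_def min_def)

lemma norm_clip_le_1: "norm (clip z) \<le> 1"
  by (simp add: norm_clip)

lemma clip_rotate: "norm w = 1 \<Longrightarrow> clip (w * z) = w * clip z"
  by (simp add: clip_def norm_mult)

lemma norm_diff_sq:
  "(norm (x - y))\<^sup>2 = (norm x)\<^sup>2 + (norm y)\<^sup>2 - 2 * Re (x * cnj (y::complex))"
  unfolding cmod_power2 by (simp add: algebra_simps power2_eq_square)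

text \<open>The displacement of \<open>z\<close> is a nonnegative multiple of its projection, a unit vector, and no point of
  the disc lies farther in that direction.\<close>

lemma clip_obtuse:
  assumes "norm q \<le> 1"
  shows "Re ((z - clip z) * cnj (q - clip z)) \<le> 0"
proof (cases "norm z \<le> 1")
  case False
  then have n: "norm (clip z) = 1" by (simp add: norm_clip)
  have "z = of_real (norm z) * clip z"
    using False by (auto simp: clip_def max_def)
  then have "z - clip z = of_real (norm z - 1) * clip z"
    by (simp add: algebra_simps)
  then have "Re ((z - clip z) * cnj (q - clip z)) = (norm z - 1) * Re (clip z * cnj (q - clip z))"
    by (simp only: mult_scaleR_left scaleR_conv_of_real[symmetric] scaleR_complex.sel)
  also have "Re (clip z * cnj (q - clip z)) = Re (clip z * cnj q) - 1"
  proof -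
    have "clip z * cnj (clip z) = 1"
      using complex_norm_square[of "clip z"] n by simp
    then show ?thesis by (simp add: right_diff_distrib)
  qed
  also have "Re (clip z * cnj q) \<le> 1"
    using complex_Re_le_cmod[of "clip z * cnj q"] n assms by (simp add: norm_mult)
  finally show ?thesis using False by (simp add: mult_nonneg_nonpos)
qed (simp add: clip_def max_def)

text \<open>The projection onto a closed convex set does not increase distances: the segment between two
  projected points makes an obtuse angle with both displacements.\<close>

lemma clip_lipschitz: "norm (clip x - clip y) \<le> norm (x - y)"
proof -
  define p q a b where "p = clip x" and "q = clip y" and "a = x - p" and "b = y - q"
  have 1: "Re (a * cnj (q - p)) \<le> 0"
    unfolding a_def p_def q_def by (rule clip_obtuse[OF norm_clip_le_1])
  have 2: "Re (b * cnj (p - q)) \<le> 0"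
    unfolding b_def p_def q_def by (rule clip_obtuse[OF norm_clip_le_1])
  have xy: "x - y = (a - b) - (q - p)"
    by (simp add: a_def b_def)
  have "(norm (x - y))\<^sup>2 = (norm (a - b))\<^sup>2 + (norm (q - p))\<^sup>2 - 2 * Re ((a - b) * cnj (q - p))"
    unfolding xy by (rule norm_diff_sq)
  moreover have "Re ((a - b) * cnj (q - p)) = Re (a * cnj (q - p)) + Re (b * cnj (p - q))"
    by (simp add: algebra_simps)
  ultimately have "(norm (q - p))\<^sup>2 \<le> (norm (x - y))\<^sup>2"
    using 1 2 zero_le_power2[of "norm (a - b)"] by linarith
  then show ?thesis
    by (simp add: p_def q_def norm_minus_commute)
qed

lemma norm_triple_diff:
  fixes a b c a' b' c' :: complex
  assumes "norm a \<le> 1" "norm b \<le> 1" "norm c \<le> 1" "norm a' \<le> 1" "norm b' \<le> 1" "norm c' \<le> 1"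
  shows "norm (a * b * cnj c - a' * b' * cnj c') \<le> norm (a - a') + norm (b - b') + norm (c - c')"
proof -
  have "a * b * cnj c - a' * b' * cnj c' =
      (a - a') * (b * cnj c) + (b - b') * (a' * cnj c) + cnj (c - c') * (a' * b')"
    by (simp add: algebra_simps)
  also have "norm \<dots> \<le> norm ((a - a') * (b * cnj c)) + norm ((b - b') * (a' * cnj c))
      + norm (cnj (c - c') * (a' * b'))"
    by (intro order_trans[OF norm_triangle_ineq] add_mono norm_triangle_ineq order_refl)
  also have "\<dots> \<le> norm (a - a') * 1 + norm (b - b') * 1 + norm (c - c') * 1"
    unfolding norm_mult complex_mod_cnj using assms
    by (intro add_mono mult_left_mono mult_le_one) auto
  finally show ?thesis by simp
qed

lemma sq_sum3_le: "((x::real) + y + z)\<^sup>2 \<le> 3 * (x\<^sup>2 + y\<^sup>2 + z\<^sup>2)"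
proof -
  have "0 \<le> (x - y)\<^sup>2 + (y - z)\<^sup>2 + (x - z)\<^sup>2" by simp
  then show ?thesis by (simp add: power2_eq_square algebra_simps)
qed

lemma one_minus_prod3_le:
  fixes x y z :: real
  assumes "0 \<le> x" "x \<le> 1" "0 \<le> y" "y \<le> 1" "0 \<le> z" "z \<le> 1"
  shows "1 - x * y * z \<le> (1 - x) + (1 - y) + (1 - z)"
proof -
  have "0 \<le> (1 - x) * (1 - y)" "0 \<le> (1 - x * y) * (1 - z)"
    using assms by (auto intro!: mult_nonneg_nonneg mult_le_one)
  then show ?thesis by (simp add: algebra_simps)
qed

text \<open>The variance identity for a finite family of complex numbers.\<close>

lemma sum_pairs_norm_diff:
  fixes x :: "'s \<Rightarrow> complex"
  assumes "finite S"
  shows "(\<Sum>s\<in>S. \<Sum>t\<in>S. (norm (x s - x t))\<^sup>2)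
    = 2 * real (card S) * (\<Sum>s\<in>S. (norm (x s))\<^sup>2) - 2 * (norm (\<Sum>s\<in>S. x s))\<^sup>2"
proof -
  have "(\<Sum>s\<in>S. \<Sum>t\<in>S. (norm (x s - x t))\<^sup>2)
      = (\<Sum>s\<in>S. \<Sum>t\<in>S. (norm (x s))\<^sup>2) + (\<Sum>s\<in>S. \<Sum>t\<in>S. (norm (x t))\<^sup>2)
        - 2 * Re (\<Sum>s\<in>S. \<Sum>t\<in>S. x s * cnj (x t))"
    by (simp add: norm_diff_sq sum.distrib sum_subtractf sum_distrib_left)
  also have "(\<Sum>s\<in>S. \<Sum>t\<in>S. x s * cnj (x t)) = (\<Sum>s\<in>S. x s) * cnj (\<Sum>s\<in>S. x s)"
    by (simp add: sum_product)
  also have "\<dots> = of_real ((norm (\<Sum>s\<in>S. x s))\<^sup>2)"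
    by (rule complex_norm_square[symmetric])
  finally show ?thesis by (simp add: sum_distrib_left mult.assoc)
qed

section \<open>Averaging operators on a finite group\<close>

locale finite_group = group G for G (structure) +
  assumes finite_carrier [simp]: "finite (carrier G)"
begin

lemma sum_left_translate:
  assumes "a \<in> carrier G"
  shows "(\<Sum>g\<in>carrier G. \<phi> (a \<otimes> g)) = (\<Sum>g\<in>carrier G. \<phi> g)"
  by (rule sum.reindex_bij_witness[where i = "\<lambda>g. inv a \<otimes> g" and j = "\<lambda>g. a \<otimes> g"])
    (use assms in \<open>auto simp: m_assoc[symmetric]\<close>)

lemma sum_right_translate:
  assumes "a \<in> carrier G"
  shows "(\<Sum>g\<in>carrier G. \<phi> (g \<otimes> a)) = (\<Sum>g\<in>carrier G. \<phi> g)"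
  by (rule sum.reindex_bij_witness[where i = "\<lambda>g. g \<otimes> inv a" and j = "\<lambda>g. g \<otimes> a"])
    (use assms in \<open>auto simp: m_assoc\<close>)

definition energy :: "('a \<Rightarrow> complex) \<Rightarrow> real" where
  "energy f = (\<Sum>g\<in>carrier G. (norm (f g))\<^sup>2)"

definition average :: "'a set \<Rightarrow> ('a \<Rightarrow> complex) \<Rightarrow> 'a \<Rightarrow> complex" where
  "average S f g = (\<Sum>s\<in>S. f (inv s \<otimes> g)) / of_nat (card S)"

definition spread :: "'a set \<Rightarrow> ('a \<Rightarrow> complex) \<Rightarrow> real" where
  "spread S f = (\<Sum>g\<in>carrier G. \<Sum>s\<in>S. \<Sum>t\<in>S. (norm (f (inv s \<otimes> g) - f (inv t \<otimes> g)))\<^sup>2)"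

lemma energy_nonneg: "0 \<le> energy f"
  by (simp add: energy_def sum_nonneg)

lemma spread_nonneg: "0 \<le> spread S f"
  by (simp add: spread_def sum_nonneg)

lemma order_pos: "0 < card (carrier G)"
  using one_closed by (subst card_gt_0_iff) auto

lemma energy_cong: "(\<And>g. g \<in> carrier G \<Longrightarrow> f g = h g) \<Longrightarrow> energy f = energy h"
  by (simp add: energy_def)

lemma energy_scale: "energy (\<lambda>g. c * f g) = (norm c)\<^sup>2 * energy f"
  by (simp add: energy_def norm_mult power_mult_distrib sum_distrib_left)

lemma energy_left_translate: "a \<in> carrier G \<Longrightarrow> energy (\<lambda>g. f (a \<otimes> g)) = energy f"
  unfolding energy_def by (rule sum_left_translate[where \<phi> = "\<lambda>g. (norm (f g))\<^sup>2"])

lemma energy_sub_mean: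
  "energy (\<lambda>g. f g - (\<Sum>h\<in>carrier G. f h) / of_nat (card (carrier G)))
    = energy f - (norm (\<Sum>h\<in>carrier G. f h))\<^sup>2 / card (carrier G)"
proof -
  define n T where "n = real (card (carrier G))" and "T = (\<Sum>h\<in>carrier G. f h)"
  have n: "n > 0" using order_pos by (simp add: n_def)
  have "energy (\<lambda>g. f g - T / of_real n)
      = energy f + (\<Sum>g\<in>carrier G. (norm (T / of_real n))\<^sup>2) - 2 * Re (T * cnj (T / of_real n))"
  proof -
    have "(\<Sum>g\<in>carrier G. 2 * Re (f g * cnj (T / of_real n)))
        = 2 * Re (\<Sum>g\<in>carrier G. f g * cnj (T / of_real n))"
      by (simp only: Re_sum sum_distrib_left)
    also have "(\<Sum>g\<in>carrier G. f g * cnj (T / of_real n)) = T * cnj (T / of_real n)"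
      unfolding T_def by (rule sum_distrib_right[symmetric])
    finally show ?thesis
      unfolding energy_def norm_diff_sq by (simp only: sum.distrib sum_subtractf)
  qed
  also have "(\<Sum>g\<in>carrier G. (norm (T / of_real n))\<^sup>2) = (norm T)\<^sup>2 / n"
    using n by (simp add: n_def norm_divide power2_eq_square field_simps)
  also have "T * cnj (T / of_real n) = of_real ((norm T)\<^sup>2 / n)"
    using complex_norm_square[of T] by simp
  finally show ?thesis by (simp add: n_def T_def)
qed

text \<open>The displacements of the translates of a function measure how much averaging loses: this is
  the variance identity, pointwise.\<close>

lemma spread_eq_energy_loss:
  assumes "S \<subseteq> carrier G" "S \<noteq> {}"
  shows "spread S f = 2 * (real (card S))\<^sup>2 * (energy f - energy (average S f))"
proof -
  have fS: "finite S" using assms(1) by (rule finite_subset) simp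
  define k where "k = real (card S)"
  have k: "k > 0" using fS assms by (simp add: k_def card_gt_0_iff)
  have "spread S f = (\<Sum>g\<in>carrier G. 2 * k * (\<Sum>s\<in>S. (norm (f (inv s \<otimes> g)))\<^sup>2)
      - 2 * (norm (\<Sum>s\<in>S. f (inv s \<otimes> g)))\<^sup>2)"
    unfolding spread_def sum_pairs_norm_diff[OF fS] k_def ..
  also have "\<dots> = 2 * k * (\<Sum>s\<in>S. energy (\<lambda>g. f (inv s \<otimes> g)))
      - 2 * (\<Sum>g\<in>carrier G. (norm (\<Sum>s\<in>S. f (inv s \<otimes> g)))\<^sup>2)"
    unfolding energy_def sum_subtractf sum_distrib_left[symmetric] by (subst sum.swap) simp
  also have "(\<Sum>s\<in>S. energy (\<lambda>g. f (inv s \<otimes> g))) = k * energy f"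
    using assms by (simp add: energy_left_translate subset_iff k_def)
  also have "(\<Sum>g\<in>carrier G. (norm (\<Sum>s\<in>S. f (inv s \<otimes> g)))\<^sup>2) = k\<^sup>2 * energy (average S f)"
    using k by (simp add: energy_def average_def norm_divide k_def sum_distrib_left power_divide)
  finally show ?thesis
    by (simp add: k_def power2_eq_square algebra_simps)
qed

text \<open>The loss of energy is a multiple of the spread, a sum of squares.\<close>

lemma energy_average_le:
  assumes "S \<subseteq> carrier G"
  shows "energy (average S f) \<le> energy f"
proof (cases "S = {}")
  case True
  then show ?thesis using energy_nonneg by (simp add: average_def energy_def)
next
  case False
  then have "0 < real (card S)" using finite_subset[OF assms] by (simp add: card_gt_0_iff)
  then show ?thesis
    using spread_eq_energy_loss[OF assms False, of f] spread_nonneg[of S f]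
    by (simp add: zero_le_mult_iff)
qed

lemma spread_mono:
  assumes "S \<subseteq> carrier G"
    and "\<And>g h. g \<in> carrier G \<Longrightarrow> h \<in> carrier G \<Longrightarrow> norm (f' g - f' h) \<le> norm (f g - f h)"
  shows "spread S f' \<le> spread S f"
  unfolding spread_def using assms
  by (intro sum_mono power_mono) (auto simp: subset_iff)

lemma spread_right_translate:
  assumes "a \<in> carrier G" "S \<subseteq> carrier G"
  shows "spread S (\<lambda>g. f (g \<otimes> a)) = spread S f"
proof -
  have "spread S (\<lambda>g. f (g \<otimes> a)) = (\<Sum>g\<in>carrier G. \<Sum>s\<in>S. \<Sum>t\<in>S.
      (norm (f (inv s \<otimes> (g \<otimes> a)) - f (inv t \<otimes> (g \<otimes> a))))\<^sup>2)"
    unfolding spread_def using assms by (intro sum.cong refl) (simp add: m_assoc subset_iff)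
  also have "\<dots> = spread S f"
    unfolding spread_def by (rule sum_right_translate[OF assms(1)])
  finally show ?thesis .
qed

text \<open>Bounded functions of small spread have products of small spread; this is why the functions under
  study have to be bounded, and not merely bounded in mean square.\<close>

lemma spread_triple:
  assumes S: "S \<subseteq> carrier G"
    and "\<And>g. g \<in> carrier G \<Longrightarrow> norm (a g) \<le> 1" "\<And>g. g \<in> carrier G \<Longrightarrow> norm (b g) \<le> 1"
      "\<And>g. g \<in> carrier G \<Longrightarrow> norm (c g) \<le> 1"
  shows "spread S (\<lambda>g. a g * b g * cnj (c g)) \<le> 3 * (spread S a + spread S b + spread S c)"
proof -
  have "(norm (a g * b g * cnj (c g) - a h * b h * cnj (c h)))\<^sup>2
      \<le> 3 * ((norm (a g - a h))\<^sup>2 + (norm (b g - b h))\<^sup>2 + (norm (c g - c h))\<^sup>2)"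
    if "g \<in> carrier G" "h \<in> carrier G" for g h
    using that assms
    by (intro order_trans[OF power_mono[OF norm_triple_diff] sq_sum3_le]) auto
  then have "spread S (\<lambda>g. a g * b g * cnj (c g)) \<le> (\<Sum>g\<in>carrier G. \<Sum>s\<in>S. \<Sum>t\<in>S.
      3 * ((norm (a (inv s \<otimes> g) - a (inv t \<otimes> g)))\<^sup>2 + (norm (b (inv s \<otimes> g) - b (inv t \<otimes> g)))\<^sup>2
        + (norm (c (inv s \<otimes> g) - c (inv t \<otimes> g)))\<^sup>2))"
    unfolding spread_def using S by (intro sum_mono) (auto simp: subset_iff)
  also have "\<dots> = 3 * (spread S a + spread S b + spread S c)"
    by (simp add: spread_def sum_distrib_left sum.distrib)
  finally show ?thesis .
qed

text \<open>A small spread controls each single pair of translates, at the cost of a factor of the size of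
  the set: compare both translates with all the others.\<close>

lemma displacement_le_spread:
  assumes S: "S \<subseteq> carrier G" and s: "s \<in> S" and t: "t \<in> S"
  shows "real (card S) * energy (\<lambda>h. f (inv s \<otimes> t \<otimes> h) - f h) \<le> 2 * spread S f"
proof -
  have fS: "finite S" using S by (rule finite_subset) simp
  have sc: "s \<in> carrier G" and tc: "t \<in> carrier G" using s t S by auto
  have "(norm (x - y))\<^sup>2 \<le> 2 * ((norm (x - z))\<^sup>2 + (norm (z - y))\<^sup>2)" for x y z :: complex
  proof -
    have "(norm (x - y))\<^sup>2 \<le> (norm (x - z) + norm (z - y))\<^sup>2"
      using norm_triangle_ineq[of "x - z" "z - y"] by (intro power_mono) auto
    moreover have "0 \<le> (norm (x - z) - norm (z - y))\<^sup>2" by simp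
    ultimately show ?thesis by (simp add: power2_eq_square algebra_simps)
  qed
  note tri = this
  define d where "d s t = (\<Sum>g\<in>carrier G. (norm (f (inv s \<otimes> g) - f (inv t \<otimes> g)))\<^sup>2)" for s t
  have d: "d s t \<le> 2 * (d s r + d r t)" for r
    unfolding d_def sum_distrib_left sum.distrib[symmetric] by (intro sum_mono tri)
  have nn: "0 \<le> d s t" for s t by (simp add: d_def sum_nonneg)
  have comm: "d s t = d t s" for s t by (simp add: d_def norm_minus_commute)
  have spread: "spread S f = (\<Sum>s\<in>S. \<Sum>t\<in>S. d s t)"
    unfolding spread_def d_def
    by (subst sum.swap, rule sum.cong[OF refl], subst sum.swap, rule refl)
  have "real (card S) * d s t = (\<Sum>r\<in>S. d s t)" by simp
  also have "\<dots> \<le> (\<Sum>r\<in>S. 2 * (d s r + d t r))"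
    using d comm by (intro sum_mono) metis
  also have "\<dots> = 2 * ((\<Sum>r\<in>S. d s r) + (\<Sum>r\<in>S. d t r))"
    by (simp add: sum_distrib_left sum.distrib)
  also have "\<dots> \<le> 2 * spread S f" if "s \<noteq> t"
  proof -
    have "(\<Sum>q\<in>{s, t}. \<Sum>r\<in>S. d q r) \<le> spread S f"
      unfolding spread using s t fS nn by (intro sum_mono2) (auto intro: sum_nonneg)
    then show ?thesis using that by simp
  qed
  finally have 1: "real (card S) * d s t \<le> 2 * spread S f" if "s \<noteq> t" using that by simp
  have 2: "energy (\<lambda>h. f (inv s \<otimes> t \<otimes> h) - f h) = d s t"
  proof -
    have "d s t = (\<Sum>g\<in>carrier G. (norm (f (inv s \<otimes> (t \<otimes> g)) - f (inv t \<otimes> (t \<otimes> g))))\<^sup>2)"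
      unfolding d_def by (rule sum_left_translate[OF tc, symmetric])
    also have "\<dots> = energy (\<lambda>h. f (inv s \<otimes> t \<otimes> h) - f h)"
      unfolding energy_def using sc tc
      by (intro sum.cong refl) (simp add: m_assoc[symmetric])
    finally show ?thesis by simp
  qed
  show ?thesis
  proof (cases "s = t")
    case True
    then have "d s t = 0" by (simp add: d_def)
    then show ?thesis using spread_nonneg[of S f] unfolding 2 by simp
  qed (use 1 2 in simp)
qed

end

section \<open>A normal subgroup whose nontrivial characters form one orbit\<close>

text \<open>The action of the group on characters of a normal subgroup \<open>V\<close> by conjugation.  Characters of \<open>V\<close>
  are functions on the whole type with value 0 outside \<open>V\<close>, so that characters that agree on \<open>V\<close> are
  equal.\<close>

definition (in finite_group) twist :: "'a set \<Rightarrow> 'a \<Rightarrow> ('a \<Rightarrow> complex) \<Rightarrow> 'a \<Rightarrow> complex" where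
  "twist V h \<psi> = (\<lambda>v. if v \<in> V then \<psi> (inv h \<otimes> v \<otimes> h) else 0)"

text \<open>As \<open>X\<close> is closed under products and separates the points of \<open>V\<close>, it is the whole dual group of \<open>V\<close>,
  and \<open>V\<close> is abelian.\<close>

locale character_orbit = finite_group G for G (structure) +
  fixes V :: "'a set" and X :: "('a \<Rightarrow> complex) set"
  assumes V_subgroup: "subgroup V G"
    and V_conj: "\<And>g v. g \<in> carrier G \<Longrightarrow> v \<in> V \<Longrightarrow> inv g \<otimes> v \<otimes> g \<in> V"
    and finite_X: "finite X"
    and char_mult: "\<And>\<psi> v w. \<psi> \<in> X \<Longrightarrow> v \<in> V \<Longrightarrow> w \<in> V \<Longrightarrow> \<psi> (v \<otimes> w) = \<psi> v * \<psi> w"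
    and char_norm: "\<And>\<psi> v. \<psi> \<in> X \<Longrightarrow> v \<in> V \<Longrightarrow> norm (\<psi> v) = 1"
    and char_outside: "\<And>\<psi> v. \<psi> \<in> X \<Longrightarrow> v \<notin> V \<Longrightarrow> \<psi> v = 0"
    and X_one: "(\<lambda>v. if v \<in> V then 1 else 0) \<in> X"
    and X_mult: "\<And>\<psi> \<phi>. \<psi> \<in> X \<Longrightarrow> \<phi> \<in> X \<Longrightarrow> (\<lambda>v. \<psi> v * \<phi> v) \<in> X"
    and X_twist: "\<And>\<psi> h. \<psi> \<in> X \<Longrightarrow> h \<in> carrier G \<Longrightarrow> twist V h \<psi> \<in> X"
    and X_separates: "\<And>v. v \<in> V \<Longrightarrow> v \<noteq> \<one> \<Longrightarrow> \<exists>\<psi>\<in>X. \<psi> v \<noteq> 1"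
    and X_transitive: "\<And>\<psi> \<phi>. \<psi> \<in> X \<Longrightarrow> \<phi> \<in> X \<Longrightarrow> \<psi> \<noteq> (\<lambda>v. if v \<in> V then 1 else 0) \<Longrightarrow>
      \<phi> \<noteq> (\<lambda>v. if v \<in> V then 1 else 0) \<Longrightarrow> \<exists>h\<in>carrier G. \<phi> = twist V h \<psi>"
begin

abbreviation triv :: "'a \<Rightarrow> complex" where
  "triv \<equiv> (\<lambda>v. if v \<in> V then 1 else 0)"

lemma V_carrier: "v \<in> V \<Longrightarrow> v \<in> carrier G"
  using subgroup.mem_carrier[OF V_subgroup] .

lemma finite_V: "finite V"
  using V_carrier by (intro finite_subset[OF _ finite_carrier]) auto

lemma V_one: "\<one> \<in> V"
  by (rule subgroup.one_closed[OF V_subgroup])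

lemma V_mult: "v \<in> V \<Longrightarrow> w \<in> V \<Longrightarrow> v \<otimes> w \<in> V"
  by (rule subgroup.m_closed[OF V_subgroup])

lemma V_inv: "v \<in> V \<Longrightarrow> inv v \<in> V"
  by (rule subgroup.m_inv_closed[OF V_subgroup])

lemma char_one:
  assumes "\<psi> \<in> X"
  shows "\<psi> \<one> = 1"
proof -
  have "\<psi> \<one> * \<psi> \<one> = \<psi> \<one>"
    using char_mult[OF assms V_one V_one] by simp
  moreover have "\<psi> \<one> \<noteq> 0"
    using char_norm[OF assms V_one] by auto
  ultimately show ?thesis by simp
qed

lemma char_inv:
  assumes "\<psi> \<in> X" "v \<in> V"
  shows "\<psi> (inv v) = cnj (\<psi> v)"
proof -
  have "\<psi> (inv v) * \<psi> v = 1"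
    using char_mult[OF assms(1) V_inv[OF assms(2)] assms(2)] assms
    by (simp add: char_one V_carrier)
  moreover have "cnj (\<psi> v) * \<psi> v = 1"
    using complex_norm_square[of "\<psi> v"] char_norm[OF assms] by (simp add: mult.commute)
  moreover have "\<psi> v \<noteq> 0" using char_norm[OF assms] by auto
  ultimately show ?thesis by (metis mult_right_cancel)
qed

lemma char_differ:
  assumes "\<psi> \<in> X" "\<phi> \<in> X" "\<psi> \<noteq> \<phi>"
  obtains v where "v \<in> V" "\<psi> v \<noteq> \<phi> v"
  using assms char_outside by (metis ext)

lemma sum_V_translate:
  assumes "w \<in> V"
  shows "(\<Sum>v\<in>V. \<phi> (w \<otimes> v)) = (\<Sum>v\<in>V. \<phi> v)"
  by (rule sum.reindex_bij_witness[where i = "\<lambda>g. inv w \<otimes> g" and j = "\<lambda>g. w \<otimes> g"])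
    (use assms V_mult V_inv V_carrier in \<open>auto simp: m_assoc[symmetric]\<close>)

lemma sum_equivariant_eq_0:
  assumes "\<And>g. g \<in> carrier G \<Longrightarrow> F (g \<otimes> v) = z * F g" "v \<in> V" "z \<noteq> (1::complex)"
  shows "(\<Sum>g\<in>carrier G. F g) = 0"
proof -
  have "(\<Sum>g\<in>carrier G. F g) = (\<Sum>g\<in>carrier G. F (g \<otimes> v))"
    by (rule sum_right_translate[OF V_carrier[OF assms(2)], symmetric])
  also have "\<dots> = z * (\<Sum>g\<in>carrier G. F g)"
    by (simp add: assms(1) sum_distrib_left)
  finally show ?thesis using assms(3) by simp
qed

lemma sum_char_eq_0:
  assumes "\<psi> \<in> X" "\<psi> \<noteq> triv"
  shows "(\<Sum>v\<in>V. \<psi> v) = 0"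
proof -
  obtain w where w: "w \<in> V" "\<psi> w \<noteq> 1"
    using char_differ[OF assms(1) X_one assms(2)] by auto
  have "(\<Sum>v\<in>V. \<psi> v) = (\<Sum>v\<in>V. \<psi> (w \<otimes> v))"
    by (rule sum_V_translate[OF w(1), symmetric])
  also have "\<dots> = \<psi> w * (\<Sum>v\<in>V. \<psi> v)"
    by (simp add: char_mult assms w sum_distrib_left)
  finally show ?thesis using w by simp
qed

lemma sum_X_eq_0:
  assumes "v \<in> V" "v \<noteq> \<one>"
  shows "(\<Sum>\<psi>\<in>X. \<psi> v) = 0"
proof -
  obtain \<phi> where \<phi>: "\<phi> \<in> X" "\<phi> v \<noteq> 1" using X_separates[OF assms] by auto
  define m where "m \<psi> = (\<lambda>v. \<phi> v * \<psi> v)" for \<psi>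
  have inj: "inj_on m X"
  proof (rule inj_onI)
    fix \<psi> \<psi>' assume *: "\<psi> \<in> X" "\<psi>' \<in> X" "m \<psi> = m \<psi>'"
    show "\<psi> = \<psi>'"
    proof
      fix w show "\<psi> w = \<psi>' w"
        using fun_cong[OF *(3), of w] char_norm[OF \<phi>(1), of w] *(1,2)
        by (cases "w \<in> V") (auto simp: m_def char_outside)
    qed
  qed
  have "m ` X \<subseteq> X" unfolding m_def using X_mult[OF \<phi>(1)] by auto
  then have "m ` X = X" using inj finite_X by (simp add: endo_inj_surj)
  then have "(\<Sum>\<psi>\<in>X. \<psi> v) = (\<Sum>\<psi>\<in>m ` X. \<psi> v)" by simp
  also have "\<dots> = \<phi> v * (\<Sum>\<psi>\<in>X. \<psi> v)"
    unfolding sum.reindex[OF inj] by (simp add: m_def sum_distrib_left)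
  finally show ?thesis using \<phi> by simp
qed

text \<open>Both numbers are the sum of all values of all characters, by the two orthogonality relations.\<close>

lemma card_X: "card X = card V"
proof -
  have "(\<Sum>\<psi>\<in>X. \<Sum>v\<in>V. \<psi> v) = (\<Sum>\<psi>\<in>X. if \<psi> = triv then of_nat (card V) else 0)"
    by (rule sum.cong) (auto simp: sum_char_eq_0)
  also have "\<dots> = of_nat (card V)"
    using X_one finite_X by simp
  finally have 1: "(\<Sum>\<psi>\<in>X. \<Sum>v\<in>V. \<psi> v) = of_nat (card V)" .
  have "(\<Sum>\<psi>\<in>X. \<Sum>v\<in>V. \<psi> v) = (\<Sum>v\<in>V. \<Sum>\<psi>\<in>X. \<psi> v)"
    by (rule sum.swap)
  also have "\<dots> = (\<Sum>v\<in>V. if v = \<one> then of_nat (card X) else 0)"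
    by (rule sum.cong) (auto simp: sum_X_eq_0 char_one)
  also have "\<dots> = of_nat (card X)"
    using V_one finite_V by simp
  finally have "of_nat (card V) = (of_nat (card X) :: complex)" using 1 by simp
  then show ?thesis by simp
qed

lemma card_V_pos: "0 < card V"
  using V_one finite_V by (auto simp: card_gt_0_iff)

lemma twist_mult:
  assumes "h \<in> carrier G" "k \<in> carrier G"
  shows "twist V k (twist V h \<psi>) = twist V (k \<otimes> h) \<psi>"
proof
  fix v
  show "twist V k (twist V h \<psi>) v = twist V (k \<otimes> h) \<psi> v"
    using assms V_conj V_carrier by (auto simp: twist_def inv_mult_group m_assoc)
qed

lemma twist_one:
  assumes "\<psi> \<in> X"
  shows "twist V \<one> \<psi> = \<psi>"
  using assms by (auto simp: twist_def char_outside V_carrier)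

lemma twist_triv: "h \<in> carrier G \<Longrightarrow> twist V h triv = triv"
  by (auto simp: twist_def V_conj)

lemma twist_inv_twist:
  assumes "h \<in> carrier G" "\<psi> \<in> X"
  shows "twist V (inv h) (twist V h \<psi>) = \<psi>" "twist V h (twist V (inv h) \<psi>) = \<psi>"
  using assms by (simp_all add: twist_mult twist_one)

lemma twist_eq_triv_iff:
  assumes "h \<in> carrier G" "\<psi> \<in> X"
  shows "twist V h \<psi> = triv \<longleftrightarrow> \<psi> = triv"
  using assms twist_inv_twist(1)[OF assms] twist_triv by (metis inv_closed)

text \<open>The elements that carry \<open>\<chi>\<close> to \<open>\<psi>\<close> form a coset of the stabiliser of \<open>\<chi>\<close>.\<close>

lemma card_twist_fibre:
  assumes \<chi>: "\<chi> \<in> X" "\<chi> \<noteq> triv" and \<psi>: "\<psi> \<in> X" "\<psi> \<noteq> triv"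
  shows "card {h \<in> carrier G. twist V h \<chi> = \<psi>} = card {h \<in> carrier G. twist V h \<chi> = \<chi>}"
proof -
  obtain k where k: "k \<in> carrier G" "\<psi> = twist V k \<chi>"
    using X_transitive[OF \<chi>(1) \<psi>(1) \<chi>(2) \<psi>(2)] by auto
  have "bij_betw (\<lambda>h. k \<otimes> h) {h \<in> carrier G. twist V h \<chi> = \<chi>} {h \<in> carrier G. twist V h \<chi> = \<psi>}"
  proof (rule bij_betw_byWitness[where f' = "\<lambda>h. inv k \<otimes> h"])
    show "\<forall>a\<in>{h \<in> carrier G. twist V h \<chi> = \<chi>}. inv k \<otimes> (k \<otimes> a) = a"
      "\<forall>a\<in>{h \<in> carrier G. twist V h \<chi> = \<psi>}. k \<otimes> (inv k \<otimes> a) = a"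
      using k by (auto simp: m_assoc[symmetric])
    show "(\<lambda>h. k \<otimes> h) ` {h \<in> carrier G. twist V h \<chi> = \<chi>} \<subseteq> {h \<in> carrier G. twist V h \<chi> = \<psi>}"
      using k by (auto simp: twist_mult[symmetric])
    show "(\<lambda>h. inv k \<otimes> h) ` {h \<in> carrier G. twist V h \<chi> = \<psi>} \<subseteq> {h \<in> carrier G. twist V h \<chi> = \<chi>}"
      using k \<chi> by (auto simp: twist_mult[symmetric] twist_inv_twist)
  qed
  then show ?thesis by (rule bij_betw_same_card[symmetric])
qed

lemma card_carrier_eq:
  assumes \<chi>: "\<chi> \<in> X" "\<chi> \<noteq> triv"
  shows "card (carrier G) = (card V - 1) * card {h \<in> carrier G. twist V h \<chi> = \<chi>}"
proof -
  have "card (carrier G) = (\<Sum>\<psi>\<in>(\<lambda>h. twist V h \<chi>) ` carrier G. card {h \<in> carrier G. twist V h \<chi> = \<psi>})"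
    using sum.image_gen[OF finite_carrier, of "\<lambda>_. 1::nat" "\<lambda>h. twist V h \<chi>"] by simp
  also have "(\<lambda>h. twist V h \<chi>) ` carrier G = X - {triv}"
    using X_twist[OF \<chi>(1)] twist_eq_triv_iff[OF _ \<chi>(1)] \<chi>(2) X_transitive[OF \<chi>(1) _ \<chi>(2)] by auto
  also have "(\<Sum>\<psi>\<in>X - {triv}. card {h \<in> carrier G. twist V h \<chi> = \<psi>})
      = (card X - 1) * card {h \<in> carrier G. twist V h \<chi> = \<chi>}"
    using X_one finite_X by (simp add: card_twist_fibre[OF \<chi>])
  finally show ?thesis by (simp add: card_X)
qed

text \<open>The functions invariant under \<open>V\<close> are the functions on the quotient by \<open>V\<close>, so this is a spectral
  gap \<open>1 - \<rho>\<close> for the image of \<open>S\<close> in the quotient.\<close>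

definition contracts_invariant :: "'a set \<Rightarrow> real \<Rightarrow> bool" where
  "contracts_invariant S \<rho> \<longleftrightarrow> (\<forall>\<phi>. (\<forall>g\<in>carrier G. \<forall>v\<in>V. \<phi> (g \<otimes> v) = \<phi> g) \<longrightarrow>
     (\<Sum>g\<in>carrier G. \<phi> g) = 0 \<longrightarrow> energy (average S \<phi>) \<le> \<rho>\<^sup>2 * energy \<phi>)"

text \<open>Subtracting the mean changes no displacement, so the spread of a function bounds its variance.\<close>

lemma variance_le_spread:
  assumes S: "S \<subseteq> carrier G" "S \<noteq> {}" and \<rho>: "0 \<le> \<rho>" "\<rho> < 1" "contracts_invariant S \<rho>"
    and F: "\<And>g v. g \<in> carrier G \<Longrightarrow> v \<in> V \<Longrightarrow> F (g \<otimes> v) = F g"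
  shows "2 * (real (card S))\<^sup>2 * (1 - \<rho>) * (energy F - (norm (\<Sum>g\<in>carrier G. F g))\<^sup>2 / card (carrier G))
    \<le> spread S F"
proof -
  define F0 where "F0 g = F g - (\<Sum>g\<in>carrier G. F g) / of_nat (card (carrier G))" for g
  have "spread S F = spread S F0"
    by (simp add: spread_def F0_def)
  also have "\<dots> = 2 * (real (card S))\<^sup>2 * (energy F0 - energy (average S F0))"
    by (rule spread_eq_energy_loss[OF S])
  finally have 1: "spread S F = 2 * (real (card S))\<^sup>2 * (energy F0 - energy (average S F0))" .
  have "(\<Sum>g\<in>carrier G. F0 g) = 0"
    using order_pos by (simp add: F0_def sum_subtractf)
  moreover have "\<forall>g\<in>carrier G. \<forall>v\<in>V. F0 (g \<otimes> v) = F0 g"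
    by (simp add: F0_def F)
  ultimately have "energy (average S F0) \<le> \<rho>\<^sup>2 * energy F0"
    using \<rho>(3) by (simp add: contracts_invariant_def)
  moreover have "\<rho>\<^sup>2 * energy F0 \<le> \<rho> * energy F0"
    using \<rho> energy_nonneg[of F0] by (intro mult_right_mono) (auto simp: power2_eq_square mult_left_le)
  ultimately have "(1 - \<rho>) * energy F0 \<le> energy F0 - energy (average S F0)"
    by (simp add: algebra_simps)
  then have "2 * (real (card S))\<^sup>2 * ((1 - \<rho>) * energy F0) \<le> spread S F"
    unfolding 1 by (intro mult_left_mono) auto
  moreover have "energy F0 = energy F - (norm (\<Sum>g\<in>carrier G. F g))\<^sup>2 / card (carrier G)"
    unfolding F0_def by (rule energy_sub_mean)
  ultimately show ?thesis by (simp add: mult.assoc)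
qed

end

section \<open>Weighted kernels of correlations\<close>

lemma sum_product_cnj:
  "(\<Sum>a\<in>A. \<Sum>b\<in>B. c * (x a * cnj (y b))) = c * ((\<Sum>a\<in>A. x a) * cnj (\<Sum>b\<in>B. y b))"
  unfolding cnj_sum by (subst sum_product) (simp only: sum_distrib_left)

lemma sum_product3:
  fixes f g h :: "'i \<Rightarrow> complex"
  shows "(\<Sum>i\<in>I. f i) * (\<Sum>i\<in>I. g i) * (\<Sum>i\<in>I. h i) = (\<Sum>i\<in>I. \<Sum>j\<in>I. \<Sum>l\<in>I. f i * g j * h l)"
  unfolding sum_product[of f I g I]
  unfolding sum_distrib_right
  unfolding sum_distrib_left ..

text \<open>The second and the third moment of the kernel are sums of nonnegative terms, one for each pair or
  triple of indices.  Thus an upper bound for the former, and a lower bound for the latter, need only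
  the correlations of the functions \<open>U i\<close>.\<close>

lemma kernel_square:
  fixes U :: "'i \<Rightarrow> 'a \<Rightarrow> complex" and w :: "'i \<Rightarrow> real"
  assumes K: "\<And>a b. K a b = (\<Sum>i\<in>I. of_real (w i) * (U i a * cnj (U i b)))"
  shows "(\<Sum>a\<in>A. \<Sum>b\<in>A. K a b * cnj (K a b))
    = (\<Sum>i\<in>I. \<Sum>j\<in>I. of_real (w i * w j * (norm (\<Sum>a\<in>A. U i a * cnj (U j a)))\<^sup>2))"
proof -
  have "(\<Sum>a\<in>A. \<Sum>b\<in>A. K a b * cnj (K a b)) = (\<Sum>a\<in>A. \<Sum>b\<in>A. \<Sum>i\<in>I. \<Sum>j\<in>I.
      of_real (w i * w j) * ((U i a * cnj (U j a)) * cnj (U i b * cnj (U j b))))"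
    unfolding K cnj_sum sum_product by (intro sum.cong refl) simp
  also have "\<dots> = (\<Sum>i\<in>I. \<Sum>j\<in>I. \<Sum>a\<in>A. \<Sum>b\<in>A.
      of_real (w i * w j) * ((U i a * cnj (U j a)) * cnj (U i b * cnj (U j b))))"
    unfolding sum.swap[of _ I A] ..
  also have "\<dots> = (\<Sum>i\<in>I. \<Sum>j\<in>I. of_real (w i * w j * (norm (\<Sum>a\<in>A. U i a * cnj (U j a)))\<^sup>2))"
    unfolding sum_product_cnj complex_norm_square[symmetric] of_real_mult ..
  finally show ?thesis .
qed

lemma kernel_cube:
  fixes U :: "'i \<Rightarrow> 'a \<Rightarrow> complex" and w :: "'i \<Rightarrow> real"
  assumes K: "\<And>a b. K a b = (\<Sum>i\<in>I. of_real (w i) * (U i a * cnj (U i b)))"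
  shows "(\<Sum>a\<in>A. \<Sum>b\<in>A. K a b * K a b * cnj (K a b))
    = (\<Sum>i\<in>I. \<Sum>j\<in>I. \<Sum>l\<in>I.
        of_real (w i * w j * w l * (norm (\<Sum>a\<in>A. U i a * U j a * cnj (U l a)))\<^sup>2))"
proof -
  have "(\<Sum>a\<in>A. \<Sum>b\<in>A. K a b * K a b * cnj (K a b)) = (\<Sum>a\<in>A. \<Sum>b\<in>A. \<Sum>i\<in>I. \<Sum>j\<in>I. \<Sum>l\<in>I.
      of_real (w i * w j * w l) * ((U i a * U j a * cnj (U l a)) * cnj (U i b * U j b * cnj (U l b))))"
    unfolding K cnj_sum sum_product3 by (intro sum.cong refl) (simp add: mult_ac)
  also have "\<dots> = (\<Sum>i\<in>I. \<Sum>j\<in>I. \<Sum>l\<in>I. \<Sum>a\<in>A. \<Sum>b\<in>A.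
      of_real (w i * w j * w l) * ((U i a * U j a * cnj (U l a)) * cnj (U i b * U j b * cnj (U l b))))"
    unfolding sum.swap[of _ I A] ..
  also have "\<dots> = (\<Sum>i\<in>I. \<Sum>j\<in>I. \<Sum>l\<in>I.
      of_real (w i * w j * w l * (norm (\<Sum>a\<in>A. U i a * U j a * cnj (U l a)))\<^sup>2))"
    unfolding sum_product_cnj complex_norm_square[symmetric] of_real_mult ..
  finally show ?thesis .
qed

section \<open>Correlations of an almost unimodular, almost invariant function\<close>

text \<open>The function \<open>u\<close> is a putative counterexample to a spectral gap for \<open>\<chi>\<close>: it is almost unimodular in
  mean, and its translates by \<open>S\<close> are so close that averaging hardly shrinks it.  The first bound
  on the spread is to be divided by the gap \<open>1 - \<rho>\<close>; the second controls each single pair of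
  elements of \<open>S\<close>.\<close>

locale rigid_function = character_orbit +
  fixes S :: "'a set" and \<rho> :: real and \<chi> u :: "'a \<Rightarrow> complex"
  assumes S_carrier: "S \<subseteq> carrier G" and S_nonempty: "S \<noteq> {}"
    and \<rho>: "0 \<le> \<rho>" "\<rho> < 1" and contracts: "contracts_invariant S \<rho>"
    and \<chi>: "\<chi> \<in> X" "\<chi> \<noteq> triv"
    and u_le_1: "\<And>g. g \<in> carrier G \<Longrightarrow> norm (u g) \<le> 1"
    and u_equivariant: "\<And>g v. g \<in> carrier G \<Longrightarrow> v \<in> V \<Longrightarrow> u (g \<otimes> v) = \<chi> v * u g"
    and u_mass: "(\<Sum>g\<in>carrier G. 1 - (norm (u g))\<^sup>2) \<le> card (carrier G) / 2500"
    and u_spread_gap: "spread S u \<le> (real (card S))\<^sup>2 * (1 - \<rho>) * card (carrier G) / 10^7"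
    and u_spread_card: "spread S u \<le> real (card S) * card (carrier G) / 10^7"
begin

definition n :: real where "n = real (card (carrier G))"
definition M :: real where "M = real (card V)"
definition stab :: real where "stab = real (card {h \<in> carrier G. twist V h \<chi> = \<chi>})"

lemma n_pos: "0 < n"
  using order_pos by (simp add: n_def)

lemma n_eq: "n = (M - 1) * stab"
  using card_carrier_eq[OF \<chi>] card_V_pos by (simp add: n_def M_def stab_def of_nat_diff)

lemma M_ge_2: "2 \<le> M"
proof -
  have "M \<noteq> 1" using n_eq n_pos by auto
  then have "2 \<le> card V" using card_V_pos by (simp add: M_def)
  then show ?thesis by (simp add: M_def)
qed

lemma stab_pos: "0 < stab"
  using n_eq n_pos M_ge_2 by (simp add: zero_less_mult_iff)

text \<open>The right translates of \<open>u\<close> belong to the nontrivial characters of \<open>V\<close>.  The index \<open>None\<close> adds the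
  constant function one, which belongs to the trivial character.  The weights give the total weight
  \<open>1 / M\<close> to each of the \<open>M\<close> characters.\<close>

definition index :: "'a option set" where
  "index = insert None (Some ` carrier G)"

definition family :: "'a option \<Rightarrow> 'a \<Rightarrow> complex" where
  "family i g = (case i of None \<Rightarrow> 1 | Some h \<Rightarrow> u (g \<otimes> h))"

definition chr :: "'a option \<Rightarrow> 'a \<Rightarrow> complex" where
  "chr i = (case i of None \<Rightarrow> triv | Some h \<Rightarrow> twist V h \<chi>)"

definition weight :: "'a option \<Rightarrow> real" where
  "weight i = (case i of None \<Rightarrow> 1 / M | Some h \<Rightarrow> 1 / (M * stab))"

lemma finite_index: "finite index"
  by (simp add: index_def)

lemma sum_index: "(\<Sum>i\<in>index. \<phi> i) = \<phi> None + (\<Sum>h\<in>carrier G. \<phi> (Some h))"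
  by (simp add: index_def sum.reindex o_def)

lemma weight_nonneg: "0 \<le> weight i"
  using M_ge_2 stab_pos by (simp add: weight_def split: option.split)

lemma chr_in_X: "i \<in> index \<Longrightarrow> chr i \<in> X"
  using X_twist[OF \<chi>(1)] X_one by (auto simp: chr_def index_def)

lemma family_le_1: "i \<in> index \<Longrightarrow> g \<in> carrier G \<Longrightarrow> norm (family i g) \<le> 1"
  using u_le_1 by (auto simp: family_def index_def)

lemma family_equivariant:
  assumes "i \<in> index" "g \<in> carrier G" "v \<in> V"
  shows "family i (g \<otimes> v) = chr i v * family i g"
proof (cases i)
  case (Some h)
  then have h: "h \<in> carrier G" using assms by (auto simp: index_def)
  have "g \<otimes> v \<otimes> h = (g \<otimes> h) \<otimes> (inv h \<otimes> v \<otimes> h)"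
    using h assms V_carrier by (simp add: m_assoc) (simp add: m_assoc[symmetric])
  then show ?thesis
    using h assms V_conj u_equivariant Some by (simp add: family_def chr_def twist_def)
qed (use assms in \<open>simp add: family_def chr_def\<close>)

lemma sum_weight_fibre:
  assumes "\<psi> \<in> X"
  shows "(\<Sum>i | i \<in> index \<and> chr i = \<psi>. weight i) = 1 / M"
proof -
  have "(\<Sum>i | i \<in> index \<and> chr i = \<psi>. weight i) = (\<Sum>i\<in>index. if chr i = \<psi> then weight i else 0)"
    by (rule sum.inter_filter[OF finite_index])
  also have "\<dots> = (if triv = \<psi> then 1 / M else 0)
      + (\<Sum>h\<in>carrier G. if twist V h \<chi> = \<psi> then 1 / (M * stab) else 0)"
    unfolding sum_index by (simp add: chr_def weight_def cong: if_cong)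
  also have "(\<Sum>h\<in>carrier G. if twist V h \<chi> = \<psi> then 1 / (M * stab) else 0)
      = real (card {h \<in> carrier G. twist V h \<chi> = \<psi>}) / (M * stab)"
    by (simp add: sum.inter_filter[symmetric])
  also have "(if triv = \<psi> then 1 / M else 0) + real (card {h \<in> carrier G. twist V h \<chi> = \<psi>}) / (M * stab)
      = 1 / M"
  proof (cases "\<psi> = triv")
    case True
    then have "{h \<in> carrier G. twist V h \<chi> = \<psi>} = {}"
      using twist_eq_triv_iff[OF _ \<chi>(1)] \<chi>(2) by auto
    then show ?thesis using True by simp
  next
    case False
    have "real (card {h \<in> carrier G. twist V h \<chi> = \<psi>}) = stab"
      by (simp only: stab_def card_twist_fibre[OF \<chi> assms False])
    then show ?thesis using False stab_pos by simp
  qed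
  finally show ?thesis .
qed

lemma sum_weight: "(\<Sum>i\<in>index. weight i) = 1"
  using M_ge_2 stab_pos n_eq by (simp add: sum_index weight_def n_def[symmetric] field_simps)

lemma family_mass:
  assumes "i \<in> index"
  shows "(\<Sum>g\<in>carrier G. 1 - (norm (family i g))\<^sup>2) \<le> n / 2500"
proof (cases i)
  case (Some h)
  then have h: "h \<in> carrier G" using assms by (auto simp: index_def)
  show ?thesis
    using u_mass sum_right_translate[OF h, of "\<lambda>g. 1 - (norm (u g))\<^sup>2"]
    by (simp add: Some family_def n_def)
qed (use n_pos in \<open>simp add: family_def\<close>)

lemma family_spread:
  assumes "i \<in> index"
  shows "spread S (family i) \<le> spread S u"
proof (cases i)
  case None
  then have "spread S (family i) = 0" by (simp add: spread_def family_def)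
  then show ?thesis using spread_nonneg by simp
next
  case (Some h)
  then have h: "h \<in> carrier G" using assms by (auto simp: index_def)
  have "family i = (\<lambda>g. u (g \<otimes> h))" by (simp add: Some family_def fun_eq_iff)
  then show ?thesis using spread_right_translate[OF h S_carrier] by simp
qed

text \<open>The characters cancel, so the product is a function on the quotient by \<open>V\<close>.  Its spread is at most
  nine times that of \<open>u\<close>, so the gap makes its variance at most \<open>9 / (2 * 10^7)\<close>, while its mean
  square is at least \<open>1 - 3/2500\<close> because the three factors are almost unimodular.\<close>

lemma triple_correlation:
  assumes i: "i \<in> index" and j: "j \<in> index" and l: "l \<in> index"
    and ch: "\<And>v. v \<in> V \<Longrightarrow> chr i v * chr j v = chr l v"
  shows "799/800 * n\<^sup>2 \<le> (norm (\<Sum>g\<in>carrier G. family i g * family j g * cnj (family l g)))\<^sup>2"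
proof -
  define F where "F g = family i g * family j g * cnj (family l g)" for g
  define T where "T = (norm (\<Sum>g\<in>carrier G. F g))\<^sup>2"
  define k where "k = real (card S)"
  have k: "0 < k"
    using S_nonempty finite_subset[OF S_carrier finite_carrier] by (simp add: k_def card_gt_0_iff)
  have F: "F (g \<otimes> v) = F g" if g: "g \<in> carrier G" and v: "v \<in> V" for g v
  proof -
    have "F (g \<otimes> v) = (chr i v * chr j v * cnj (chr l v)) * F g"
      unfolding F_def using g v i j l by (simp add: family_equivariant)
    also have "chr i v * chr j v * cnj (chr l v) = 1"
      using ch[OF v] complex_norm_square[of "chr l v"] char_norm[OF chr_in_X[OF l] v] by simp
    finally show ?thesis by simp
  qed
  have "spread S F \<le> 3 * (spread S (family i) + spread S (family j) + spread S (family l))"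
    unfolding F_def using i j l family_le_1 by (intro spread_triple S_carrier)
  also have "\<dots> \<le> 9 * spread S u"
    using family_spread[OF i] family_spread[OF j] family_spread[OF l] by simp
  also have "\<dots> \<le> 9 * (k\<^sup>2 * (1 - \<rho>) * n / 10^7)"
    unfolding k_def n_def by (intro mult_left_mono u_spread_gap) simp
  finally have "spread S F \<le> 9 * (k\<^sup>2 * (1 - \<rho>) * n / 10^7)" .
  moreover define E where "E = energy F - T / n"
  have "2 * k\<^sup>2 * (1 - \<rho>) * E \<le> spread S F"
    unfolding k_def n_def T_def E_def
    by (rule variance_le_spread[OF S_carrier S_nonempty \<rho> contracts F])
  ultimately have "2 * k\<^sup>2 * (1 - \<rho>) * E \<le> 9 * (k\<^sup>2 * (1 - \<rho>) * n / 10^7)"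
    by linarith
  then have "(k\<^sup>2 * (1 - \<rho>)) * (2 * E) \<le> (k\<^sup>2 * (1 - \<rho>)) * (9 * n / 10^7)"
    by (simp only: mult_ac times_divide_eq_right)
  then have 1: "2 * (energy F - T / n) \<le> 9 * n / 10^7"
    unfolding E_def using k \<rho> by (simp only: mult_le_cancel_left_pos zero_less_power mult_pos_pos diff_gt_0_iff_gt)
  have "(\<Sum>g\<in>carrier G. 1 - (norm (F g))\<^sup>2) \<le> (\<Sum>g\<in>carrier G. (1 - (norm (family i g))\<^sup>2)
      + (1 - (norm (family j g))\<^sup>2) + (1 - (norm (family l g))\<^sup>2))"
    unfolding F_def norm_mult complex_mod_cnj power_mult_distrib
    using i j l family_le_1 by (intro sum_mono one_minus_prod3_le) (auto simp: power_le_one)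
  also have "\<dots> \<le> 3 * (n / 2500)"
    using family_mass[OF i] family_mass[OF j] family_mass[OF l] by (simp only: sum.distrib)
  finally have "n - energy F \<le> 3 * (n / 2500)"
    by (simp add: energy_def sum_subtractf n_def)
  then have "799/800 * n \<le> T / n"
    using 1 n_pos by simp
  then show ?thesis
    using n_pos by (simp add: T_def F_def field_simps power2_eq_square)
qed

lemma correlation_eq_0:
  assumes i: "i \<in> index" and j: "j \<in> index" and "chr i \<noteq> chr j"
  shows "(\<Sum>g\<in>carrier G. family i g * cnj (family j g)) = 0"
proof -
  obtain v where v: "v \<in> V" "chr i v \<noteq> chr j v"
    using char_differ[OF chr_in_X[OF i] chr_in_X[OF j] assms(3)] by auto
  show ?thesis
  proof (rule sum_equivariant_eq_0[OF _ v(1)])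
    show "family i (g \<otimes> v) * cnj (family j (g \<otimes> v))
        = (chr i v * cnj (chr j v)) * (family i g * cnj (family j g))" if "g \<in> carrier G" for g
      using that i j v by (simp add: family_equivariant)
    have "cnj (chr j v) * chr j v = 1"
      using complex_norm_square[of "chr j v"] char_norm[OF chr_in_X[OF j] v(1)]
      by (simp add: mult.commute)
    then show "chr i v * cnj (chr j v) \<noteq> 1"
      using v(2) by (metis mult.assoc mult.left_neutral mult.right_neutral)
  qed
qed

definition overlap :: "'a \<Rightarrow> 'a \<Rightarrow> complex" where
  "overlap a b = (\<Sum>i\<in>index. of_real (weight i) * (family i a * cnj (family i b)))"

text \<open>Only pairs of indices with the same character contribute, and these have total weight \<open>1 / M\<close>.\<close>

lemma sum_overlap_square_le:
  "(\<Sum>a\<in>carrier G. \<Sum>b\<in>carrier G. (norm (overlap a b))\<^sup>2) \<le> n\<^sup>2 / M"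
proof -
  have "complex_of_real (\<Sum>a\<in>carrier G. \<Sum>b\<in>carrier G. (norm (overlap a b))\<^sup>2)
      = (\<Sum>a\<in>carrier G. \<Sum>b\<in>carrier G. overlap a b * cnj (overlap a b))"
    by (simp only: of_real_sum complex_norm_square)
  also have "\<dots> = of_real (\<Sum>i\<in>index. \<Sum>j\<in>index.
      weight i * weight j * (norm (\<Sum>a\<in>carrier G. family i a * cnj (family j a)))\<^sup>2)"
    unfolding kernel_square[of overlap, OF overlap_def] by simp
  finally have "(\<Sum>a\<in>carrier G. \<Sum>b\<in>carrier G. (norm (overlap a b))\<^sup>2)
      = (\<Sum>i\<in>index. \<Sum>j\<in>index.
          weight i * weight j * (norm (\<Sum>a\<in>carrier G. family i a * cnj (family j a)))\<^sup>2)"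
    unfolding of_real_eq_iff .
  also have "\<dots> \<le> (\<Sum>i\<in>index. \<Sum>j\<in>index. if chr j = chr i then weight i * weight j * n\<^sup>2 else 0)"
  proof (intro sum_mono)
    fix i j assume i: "i \<in> index" and j: "j \<in> index"
    have "norm (\<Sum>a\<in>carrier G. family i a * cnj (family j a)) \<le> (\<Sum>a\<in>carrier G. 1)"
      using i j family_le_1 by (intro sum_norm_le) (simp add: norm_mult mult_le_one)
    then have "(norm (\<Sum>a\<in>carrier G. family i a * cnj (family j a)))\<^sup>2 \<le> n\<^sup>2"
      by (intro power_mono) (simp_all add: n_def)
    then show "weight i * weight j * (norm (\<Sum>a\<in>carrier G. family i a * cnj (family j a)))\<^sup>2
        \<le> (if chr j = chr i then weight i * weight j * n\<^sup>2 else 0)"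
      using correlation_eq_0[OF i j] by (auto intro!: mult_left_mono mult_nonneg_nonneg weight_nonneg)
  qed
  also have "\<dots> = (\<Sum>i\<in>index. weight i * n\<^sup>2 * (\<Sum>j | j \<in> index \<and> chr j = chr i. weight j))"
    by (simp add: sum.inter_filter[OF finite_index] sum_distrib_left)
      (auto intro!: sum.cong)
  also have "\<dots> = (\<Sum>i\<in>index. weight i) * (n\<^sup>2 / M)"
    unfolding sum_distrib_right by (intro sum.cong refl) (simp add: sum_weight_fibre chr_in_X)
  finally show ?thesis by (simp add: sum_weight)
qed

text \<open>The triples of indices in which the third character is the product of the first two have total
  weight \<open>1 / M\<close>, and each of them has a large correlation.  Treating the trivial character like the
  others makes this count exact, which matters when \<open>V\<close> is small.\<close>

lemma sum_overlap_cube_ge: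
  "799/800 * n\<^sup>2 / M \<le> (\<Sum>a\<in>carrier G. \<Sum>b\<in>carrier G. (norm (overlap a b))\<^sup>2 * Re (overlap a b))"
proof -
  have "799/800 * n\<^sup>2 / M = (\<Sum>i\<in>index. weight i) * ((\<Sum>i\<in>index. weight i) * (799/800 * n\<^sup>2 / M))"
    by (simp add: sum_weight)
  also have "\<dots> = (\<Sum>i\<in>index. \<Sum>j\<in>index. weight i * weight j * (799/800 * n\<^sup>2) * (1 / M))"
    by (simp add: sum_distrib_left sum_distrib_right sum_divide_distrib mult_ac)
  also have "\<dots> = (\<Sum>i\<in>index. \<Sum>j\<in>index. weight i * weight j * (799/800 * n\<^sup>2) *
      (\<Sum>l | l \<in> index \<and> chr l = (\<lambda>v. chr i v * chr j v). weight l))"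
    by (intro sum.cong refl) (simp only: sum_weight_fibre X_mult chr_in_X)
  also have "\<dots> = (\<Sum>i\<in>index. \<Sum>j\<in>index. \<Sum>l\<in>index.
      if chr l = (\<lambda>v. chr i v * chr j v) then weight i * weight j * (799/800 * n\<^sup>2) * weight l else 0)"
    by (simp add: sum.inter_filter[OF finite_index] sum_distrib_left)
      (auto intro!: sum.cong)
  also have "\<dots> \<le> (\<Sum>i\<in>index. \<Sum>j\<in>index. \<Sum>l\<in>index. weight i * weight j * weight l
      * (norm (\<Sum>a\<in>carrier G. family i a * family j a * cnj (family l a)))\<^sup>2)"
  proof (intro sum_mono)
    fix i j l assume ijl: "i \<in> index" "j \<in> index" "l \<in> index"
    have "weight i * weight j * weight l * (799/800 * n\<^sup>2) \<le> weight i * weight j * weight l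
      * (norm (\<Sum>a\<in>carrier G. family i a * family j a * cnj (family l a)))\<^sup>2"
      if "chr l = (\<lambda>v. chr i v * chr j v)"
      using triple_correlation[OF ijl] that
      by (intro mult_left_mono mult_nonneg_nonneg weight_nonneg) auto
    then show "(if chr l = (\<lambda>v. chr i v * chr j v) then weight i * weight j * (799/800 * n\<^sup>2) * weight l else 0)
      \<le> weight i * weight j * weight l
      * (norm (\<Sum>a\<in>carrier G. family i a * family j a * cnj (family l a)))\<^sup>2"
      by (auto intro!: mult_nonneg_nonneg weight_nonneg simp: mult_ac)
  qed
  also have "\<dots> = Re (\<Sum>a\<in>carrier G. \<Sum>b\<in>carrier G. overlap a b * overlap a b * cnj (overlap a b))"
    unfolding kernel_cube[of overlap, OF overlap_def] by (simp del: of_real_mult)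
  also have "\<dots> = (\<Sum>a\<in>carrier G. \<Sum>b\<in>carrier G. (norm (overlap a b))\<^sup>2 * Re (overlap a b))"
  proof -
    have "Re (overlap a b * overlap a b * cnj (overlap a b)) = (norm (overlap a b))\<^sup>2 * Re (overlap a b)"
      for a b unfolding cmod_power2 by (simp add: power2_eq_square algebra_simps)
    then show ?thesis by (simp only: Re_sum)
  qed
  finally show ?thesis .
qed

lemma overlap_eq:
  "overlap x y = of_real (1 / M) + of_real (1 / (M * stab)) *
    (\<Sum>h\<in>carrier G. u (x \<otimes> h) * cnj (u (y \<otimes> h)))"
  unfolding overlap_def sum_index by (simp add: weight_def family_def sum_distrib_left)

text \<open>The weight of an index in the group does not depend on it, so the overlap is a function of
  the quotient of its two arguments.\<close>

lemma overlap_translate: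
  assumes "g \<in> carrier G" "b \<in> carrier G"
  shows "overlap (g \<otimes> b) b = overlap g \<one>"
proof -
  have "(\<Sum>h\<in>carrier G. u (g \<otimes> b \<otimes> h) * cnj (u (b \<otimes> h)))
      = (\<Sum>h\<in>carrier G. u (g \<otimes> (b \<otimes> h)) * cnj (u (b \<otimes> h)))"
    using assms by (intro sum.cong refl) (simp add: m_assoc)
  also have "\<dots> = (\<Sum>h\<in>carrier G. u (g \<otimes> h) * cnj (u h))"
    by (rule sum_left_translate[OF assms(2)])
  finally have *: "(\<Sum>h\<in>carrier G. u (g \<otimes> b \<otimes> h) * cnj (u (b \<otimes> h)))
      = (\<Sum>h\<in>carrier G. u (g \<otimes> h) * cnj (u h))" .
  show ?thesis using * assms by (simp add: overlap_eq)
qed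

lemma sum_overlap_pairs:
  "(\<Sum>a\<in>carrier G. \<Sum>b\<in>carrier G. \<phi> (overlap a b)) = n * (\<Sum>g\<in>carrier G. (\<phi> (overlap g \<one>) :: real))"
proof -
  have "(\<Sum>a\<in>carrier G. \<Sum>b\<in>carrier G. \<phi> (overlap a b)) = (\<Sum>b\<in>carrier G. \<Sum>a\<in>carrier G. \<phi> (overlap a b))"
    by (rule sum.swap)
  also have "\<dots> = (\<Sum>b\<in>carrier G. \<Sum>g\<in>carrier G. \<phi> (overlap (g \<otimes> b) b))"
    by (rule sum.cong[OF refl]) (rule sum_right_translate[symmetric])
  also have "\<dots> = n * (\<Sum>g\<in>carrier G. \<phi> (overlap g \<one>))"
    by (simp add: overlap_translate n_def)
  finally show ?thesis .
qed

lemma overlap_le_1: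
  assumes "a \<in> carrier G" "b \<in> carrier G"
  shows "norm (overlap a b) \<le> 1"
proof -
  have "norm (overlap a b) \<le> (\<Sum>i\<in>index. weight i)"
    unfolding overlap_def
  proof (rule sum_norm_le)
    fix i assume "i \<in> index"
    then show "norm (complex_of_real (weight i) * (family i a * cnj (family i b))) \<le> weight i"
      using family_le_1 assms weight_nonneg[of i]
      by (simp add: norm_mult mult_left_le mult_le_one)
  qed
  then show ?thesis by (simp add: sum_weight)
qed

text \<open>An overlap of \<open>1 - 1/144\<close> makes the normalised displacement of \<open>u\<close> at most \<open>1/6\<close>: its square is at
  most \<open>2 * M / (M - 1) \<le> 4\<close> times \<open>1/144\<close>.  Products of six such elements then displace \<open>u\<close> by at
  most one, less than any nontrivial element of \<open>V\<close> does.\<close>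

definition near :: "'a set" where
  "near = {g \<in> carrier G. 143/144 \<le> Re (overlap g \<one>)}"

text \<open>Let \<open>q\<close> be the squared modulus of the overlap.  The sum of \<open>q\<close> is between \<open>799/800 * n / M\<close> and
  \<open>n / M\<close>, and that of \<open>q * (1 - Re \<beta>)\<close> is at most \<open>n / (800 * M)\<close>.  Hence the elements
  off \<open>near\<close> contribute at most \<open>144/800 * n / M\<close> to the former sum, and as \<open>q \<le> 1\<close>, the set \<open>near\<close> has more than half of \<open>n / M\<close> elements.\<close>

lemma card_near: "n < 2 * M * card near"
proof -
  define \<beta> where "\<beta> g = overlap g \<one>" for g
  define q where "q g = (norm (\<beta> g))\<^sup>2" for g
  have q1: "q g \<le> 1" if "g \<in> carrier G" for g
    using overlap_le_1[OF that one_closed] by (simp add: q_def \<beta>_def power_le_one)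
  have q0: "0 \<le> q g" for g by (simp add: q_def)
  have R1: "Re (\<beta> g) \<le> 1" if "g \<in> carrier G" for g
    using overlap_le_1[OF that one_closed] complex_Re_le_cmod[of "\<beta> g"] by (simp add: \<beta>_def)
  have "n * (\<Sum>g\<in>carrier G. q g) \<le> n\<^sup>2 / M"
    using sum_overlap_square_le unfolding sum_overlap_pairs[where \<phi> = "\<lambda>z. (norm z)\<^sup>2"]
    by (simp add: q_def \<beta>_def)
  then have sq: "(\<Sum>g\<in>carrier G. q g) \<le> n / M"
    using n_pos M_ge_2 by (simp add: field_simps power2_eq_square)
  have "799/800 * n\<^sup>2 / M \<le> n * (\<Sum>g\<in>carrier G. q g * Re (\<beta> g))"
    using sum_overlap_cube_ge unfolding sum_overlap_pairs[where \<phi> = "\<lambda>z. (norm z)\<^sup>2 * Re z"]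
    by (simp add: q_def \<beta>_def)
  then have cu: "799/800 * (n / M) \<le> (\<Sum>g\<in>carrier G. q g * Re (\<beta> g))"
    using n_pos M_ge_2 by (simp add: field_simps power2_eq_square)
  \<comment> \<open>Off \<open>near\<close> the factor \<open>1 - Re \<beta>\<close> is at least \<open>1/144\<close>, on it the factor is nonnegative.\<close>
  have "q g \<le> 144 * (q g * (1 - Re (\<beta> g))) + (if g \<in> near then 1 else 0)" if g: "g \<in> carrier G" for g
  proof (cases "g \<in> near")
    case True
    have "0 \<le> q g * (1 - Re (\<beta> g))" using q0[of g] R1[OF g] by simp
    then show ?thesis using True q1[OF g] by simp
  next
    case False
    then have "1 \<le> 144 * (1 - Re (\<beta> g))" using g by (simp add: near_def \<beta>_def)
    then have "q g * 1 \<le> q g * (144 * (1 - Re (\<beta> g)))" using q0 by (intro mult_left_mono)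
    then show ?thesis using False by (simp add: algebra_simps)
  qed
  then have "(\<Sum>g\<in>carrier G. q g)
      \<le> (\<Sum>g\<in>carrier G. 144 * (q g * (1 - Re (\<beta> g))) + (if g \<in> near then 1 else 0))"
    by (rule sum_mono)
  also have "\<dots> = 144 * ((\<Sum>g\<in>carrier G. q g) - (\<Sum>g\<in>carrier G. q g * Re (\<beta> g))) + card near"
  proof -
    have "carrier G \<inter> near = near" by (auto simp: near_def)
    then have "(\<Sum>g\<in>carrier G. if g \<in> near then 1 else 0) = real (card near)"
      by (simp add: sum.If_cases)
    moreover have "(\<Sum>g\<in>carrier G. 144 * (q g * (1 - Re (\<beta> g))))
        = 144 * ((\<Sum>g\<in>carrier G. q g) - (\<Sum>g\<in>carrier G. q g * Re (\<beta> g)))"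
      by (simp only: sum_distrib_left[symmetric] right_diff_distrib mult_1_right sum_subtractf)
    ultimately show ?thesis by (simp only: sum.distrib)
  qed
  finally have 1: "(\<Sum>g\<in>carrier G. q g)
      \<le> 144 * ((\<Sum>g\<in>carrier G. q g) - (\<Sum>g\<in>carrier G. q g * Re (\<beta> g))) + card near" .
  have "(\<Sum>g\<in>carrier G. q g * Re (\<beta> g)) \<le> (\<Sum>g\<in>carrier G. q g)"
    using q0 R1 by (intro sum_mono) (simp add: mult_left_le)
  moreover define y where "y = n / M"
  moreover have "0 < y" using n_pos M_ge_2 by (simp add: y_def)
  moreover have "y / 2 < c" if "Q \<le> 144 * (Q - C) + c" "Q \<le> y" "799/800 * y \<le> C" "0 < y" for Q C c
    using that by (simp add: field_simps)
  ultimately have "y / 2 < card near"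
    using 1 sq cu by blast
  then show ?thesis using M_ge_2 by (simp add: y_def field_simps)
qed

end

context rigid_function
begin

section \<open>The elements that almost fix the function form a complement\<close>

definition disp :: "'a \<Rightarrow> real" where
  "disp g = L2_set (\<lambda>h. norm (u (g \<otimes> h) - u h)) (carrier G)"

lemma disp_sq: "(disp g)\<^sup>2 = energy (\<lambda>h. u (g \<otimes> h) - u h)"
  by (simp add: disp_def L2_set_def energy_def sum_nonneg)

lemma disp_mult:
  assumes "g \<in> carrier G" "k \<in> carrier G"
  shows "disp (g \<otimes> k) \<le> disp g + disp k"
proof -
  have "disp (g \<otimes> k) \<le> L2_set (\<lambda>h. norm (u (g \<otimes> (k \<otimes> h)) - u (k \<otimes> h)) + norm (u (k \<otimes> h) - u h)) (carrier G)"
    unfolding disp_def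
  proof (rule L2_set_mono)
    fix h assume "h \<in> carrier G"
    then have "g \<otimes> k \<otimes> h = g \<otimes> (k \<otimes> h)" using assms by (simp add: m_assoc)
    then show "norm (u (g \<otimes> k \<otimes> h) - u h) \<le> norm (u (g \<otimes> (k \<otimes> h)) - u (k \<otimes> h)) + norm (u (k \<otimes> h) - u h)"
      using norm_triangle_ineq[of "u (g \<otimes> (k \<otimes> h)) - u (k \<otimes> h)" "u (k \<otimes> h) - u h"] by simp
  qed auto
  also have "\<dots> \<le> L2_set (\<lambda>h. norm (u (g \<otimes> (k \<otimes> h)) - u (k \<otimes> h))) (carrier G) + disp k"
    unfolding disp_def by (rule L2_set_triangle_ineq)
  also have "L2_set (\<lambda>h. norm (u (g \<otimes> (k \<otimes> h)) - u (k \<otimes> h))) (carrier G) = disp g"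
    unfolding disp_def L2_set_def
    using sum_left_translate[OF assms(2), of "\<lambda>h. (norm (u (g \<otimes> h) - u h))\<^sup>2"] by simp
  finally show ?thesis .
qed

lemma disp_inv:
  assumes "g \<in> carrier G"
  shows "disp (inv g) = disp g"
proof -
  have "(\<Sum>h\<in>carrier G. (norm (u (inv g \<otimes> h) - u h))\<^sup>2)
      = (\<Sum>h\<in>carrier G. (norm (u (inv g \<otimes> (g \<otimes> h)) - u (g \<otimes> h)))\<^sup>2)"
    by (rule sum_left_translate[OF assms, symmetric])
  also have "\<dots> = (\<Sum>h\<in>carrier G. (norm (u (g \<otimes> h) - u h))\<^sup>2)"
    using assms by (intro sum.cong refl) (simp add: m_assoc[symmetric] norm_minus_commute)
  finally show ?thesis by (simp add: disp_def L2_set_def)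
qed

text \<open>With the trivial character included, the weighted sum of the characters at \<open>v\<close> vanishes.\<close>

lemma sum_twist_eq:
  assumes "v \<in> V" "v \<noteq> \<one>"
  shows "(\<Sum>h\<in>carrier G. twist V h \<chi> v) = - of_real stab"
proof -
  have "(\<Sum>i\<in>index. of_real (weight i) * chr i v)
      = (\<Sum>\<psi>\<in>X. \<Sum>i | i \<in> index \<and> chr i = \<psi>. of_real (weight i) * chr i v)"
    using chr_in_X by (intro sum.group[symmetric] finite_index finite_X) auto
  also have "\<dots> = (\<Sum>\<psi>\<in>X. \<Sum>i | i \<in> index \<and> chr i = \<psi>. of_real (weight i) * \<psi> v)"
    by (intro sum.cong refl) auto
  also have "\<dots> = (\<Sum>\<psi>\<in>X. of_real (\<Sum>i | i \<in> index \<and> chr i = \<psi>. weight i) * \<psi> v)"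
    by (simp only: sum_distrib_right[symmetric] of_real_sum)
  also have "\<dots> = (\<Sum>\<psi>\<in>X. of_real (1 / M) * \<psi> v)"
    by (intro sum.cong refl) (simp only: sum_weight_fibre)
  also have "\<dots> = 0"
    using sum_X_eq_0[OF assms] by (simp only: sum_distrib_left[symmetric]) simp
  finally have "of_real (1 / M) + of_real (1 / (M * stab)) * (\<Sum>h\<in>carrier G. twist V h \<chi> v) = 0"
    unfolding sum_index using assms(1) by (simp add: weight_def chr_def sum_distrib_left)
  then show ?thesis
    using M_ge_2 stab_pos by (simp add: field_simps add_eq_0_iff)
qed

text \<open>On the coset of \<open>h\<close>, the element \<open>v\<close> multiplies \<open>u\<close> by the value at \<open>v\<close> of the twisted character,
  whose mean over \<open>h\<close> is negative.  So \<open>u\<close> and its translate are far from parallel.\<close>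

lemma disp_V:
  assumes v: "v \<in> V" "v \<noteq> \<one>"
  shows "n < (disp v)\<^sup>2"
proof -
  have *: "2 - 2 * Re (twist V h \<chi> v) - 4 * (1 - (norm (u h))\<^sup>2) \<le> (norm (u (v \<otimes> h) - u h))\<^sup>2"
    if h: "h \<in> carrier G" for h
  proof -
    define z where "z = twist V h \<chi> v"
    have "v \<otimes> h = h \<otimes> (inv h \<otimes> v \<otimes> h)"
      using h V_carrier[OF v(1)] by (simp add: m_assoc) (simp add: m_assoc[symmetric])
    then have "u (v \<otimes> h) = z * u h"
      using u_equivariant[OF h V_conj[OF h v(1)]] v by (simp add: z_def twist_def)
    then have "u (v \<otimes> h) - u h = (z - 1) * u h"
      by (simp add: algebra_simps)
    then have 1: "(norm (u (v \<otimes> h) - u h))\<^sup>2 = (norm (z - 1))\<^sup>2 * (norm (u h))\<^sup>2"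
      by (simp add: norm_mult power_mult_distrib)
    have z: "norm z = 1"
      unfolding z_def using X_twist[OF \<chi>(1) h] v by (rule_tac char_norm)
    have 2: "(norm (z - 1))\<^sup>2 = 2 - 2 * Re z"
      unfolding norm_diff_sq z by simp
    have "- 1 \<le> Re z" using abs_Re_le_cmod[of z] z by linarith
    moreover have "0 \<le> 1 - (norm (u h))\<^sup>2" using u_le_1[OF h] by (simp add: power_le_one)
    ultimately have "0 \<le> (4 - (2 - 2 * Re z)) * (1 - (norm (u h))\<^sup>2)"
      by (intro mult_nonneg_nonneg) auto
    then show ?thesis unfolding 1 2 z_def[symmetric] by (simp add: algebra_simps)
  qed
  have "2 * n + 2 * stab - 4 * (n / 2500)
      \<le> 2 * n - 2 * Re (\<Sum>h\<in>carrier G. twist V h \<chi> v) - 4 * (\<Sum>h\<in>carrier G. 1 - (norm (u h))\<^sup>2)"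
    using u_mass unfolding sum_twist_eq[OF v] by (simp add: n_def)
  also have "\<dots> = (\<Sum>h\<in>carrier G. 2 - 2 * Re (twist V h \<chi> v) - 4 * (1 - (norm (u h))\<^sup>2))"
    unfolding sum_subtractf Re_sum sum_distrib_left
    by (simp add: n_def sum_subtractf sum_distrib_left[symmetric])
  also have "\<dots> \<le> (disp v)\<^sup>2"
    unfolding disp_sq energy_def by (intro sum_mono *)
  finally show ?thesis using n_pos stab_pos by simp
qed

lemma V_trivial:
  assumes "v \<in> V" "disp v \<le> sqrt n"
  shows "v = \<one>"
proof (rule ccontr)
  assume "v \<noteq> \<one>"
  then have "n < (disp v)\<^sup>2" using disp_V assms by simp
  also have "\<dots> \<le> (sqrt n)\<^sup>2" using assms by (intro power_mono) (auto simp: disp_def)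
  finally show False using n_pos by simp
qed

lemma disp_near:
  assumes "g \<in> near"
  shows "disp g \<le> sqrt n / 6"
proof -
  have g: "g \<in> carrier G" and \<beta>: "143/144 \<le> Re (overlap g \<one>)" using assms by (auto simp: near_def)
  define T where "T = (\<Sum>h\<in>carrier G. u (g \<otimes> h) * cnj (u h))"
  have "overlap g \<one> = of_real (1 / M) + of_real (1 / (M * stab)) * T"
    unfolding overlap_eq T_def by simp
  then have "Re (overlap g \<one>) = 1 / M + 1 / (M * stab) * Re T"
    by (simp only: plus_complex.sel Re_complex_of_real scaleR_conv_of_real[symmetric] scaleR_complex.sel)
  then have T: "Re T = M * stab * Re (overlap g \<one>) - stab"
    using M_ge_2 stab_pos by (simp add: field_simps)
  have "(norm (u (g \<otimes> h) - u h))\<^sup>2 \<le> 2 - 2 * Re (u (g \<otimes> h) * cnj (u h))" if h: "h \<in> carrier G" for h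
  proof -
    have "(norm (u (g \<otimes> h)))\<^sup>2 \<le> 1" "(norm (u h))\<^sup>2 \<le> 1" using u_le_1 g h by (auto simp: power_le_one)
    then show ?thesis unfolding norm_diff_sq by linarith
  qed
  then have "(disp g)\<^sup>2 \<le> (\<Sum>h\<in>carrier G. 2 - 2 * Re (u (g \<otimes> h) * cnj (u h)))"
    unfolding disp_sq energy_def by (rule sum_mono)
  also have "\<dots> = 2 * n - 2 * Re T"
    unfolding sum_subtractf T_def Re_sum sum_distrib_left by (simp add: n_def)
  also have "\<dots> = 2 * (M * stab) * (1 - Re (overlap g \<one>))"
    unfolding T n_eq by (simp add: algebra_simps)
  also have "\<dots> \<le> 2 * (M * stab) * (1/144)"
    using \<beta> M_ge_2 stab_pos by (intro mult_left_mono) auto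
  also have "\<dots> \<le> (sqrt n / 6)\<^sup>2"
  proof -
    have "M * stab \<le> 2 * n" using M_ge_2 stab_pos unfolding n_eq by simp
    then show ?thesis using n_pos by (simp add: power_divide)
  qed
  finally show ?thesis using n_pos by (rule_tac power2_le_imp_le) auto
qed

text \<open>Twice the displacement of the elements of \<open>near\<close> is allowed, so that this set contains all products
  of two of them.\<close>

definition stabiliser :: "'a set" where
  "stabiliser = {g \<in> carrier G. disp g \<le> sqrt n / 3}"

text \<open>The elements of \<open>near\<close> lie in different cosets of \<open>V\<close>, since the quotient of two of them displaces
  \<open>u\<close> little.  So \<open>near\<close> meets more than half of the cosets, and a subset of more than half of a
  group has every element as a product of two of its own.\<close>

lemma stabiliser_meets_cosets:
  assumes g: "g \<in> carrier G"
  obtains k v where "k \<in> stabiliser" "v \<in> V" "g = k \<otimes> v"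
proof -
  have near: "h \<in> carrier G" if "h \<in> near" for h using that by (simp add: near_def)
  define A where "A = (\<lambda>(h, v). h \<otimes> v) ` (near \<times> V)"
  define B where "B = (\<lambda>a. g \<otimes> inv a) ` A"
  have A: "A \<subseteq> carrier G" using near V_carrier by (auto simp: A_def)
  have B: "B \<subseteq> carrier G" using A g by (auto simp: B_def)
  have inj: "inj_on (\<lambda>(h, v). h \<otimes> v) (near \<times> V)"
  proof (rule inj_onI, clarify)
    fix h v h' v' assume *: "h \<in> near" "v \<in> V" "h' \<in> near" "v' \<in> V" "h \<otimes> v = h' \<otimes> v'"
    note c = *(1,3)[THEN near] *(2,4)[THEN V_carrier]
    have "inv h' \<otimes> h = inv h' \<otimes> (h \<otimes> v \<otimes> inv v)" using c by (simp add: m_assoc)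
    also have "\<dots> = v' \<otimes> inv v" using c unfolding *(5) by (simp add: m_assoc[symmetric])
    finally have eq: "inv h' \<otimes> h = v' \<otimes> inv v" .
    have "disp (inv h' \<otimes> h) \<le> sqrt n / 6 + sqrt n / 6"
      using disp_mult[of "inv h'" h] disp_inv[OF c(2)] disp_near[OF *(1)] disp_near[OF *(3)] c by simp
    also have "\<dots> \<le> sqrt n" using n_pos by simp
    finally have "inv h' \<otimes> h = \<one>"
      using V_mult[OF *(4) V_inv[OF *(2)]] eq by (intro V_trivial) auto
    then have "h = h'" using c by (metis inv_closed inv_equality inv_inv)
    then show "h = h' \<and> v = v'" using *(5) c by simp
  qed
  have cA: "card A = card near * card V"
    unfolding A_def by (simp add: card_image[OF inj] card_cartesian_product)
  have "inj_on (\<lambda>a. g \<otimes> inv a) A"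
    using A g by (intro inj_onI) (auto simp: Units_eq subset_iff dest: inj_onD[OF inv_inj])
  then have cB: "card B = card A" unfolding B_def by (rule card_image)
  have "A \<inter> B \<noteq> {}"
  proof
    assume "A \<inter> B = {}"
    then have "card A + card B = card (A \<union> B)"
      using A B by (intro card_Un_disjoint[symmetric]) (auto intro: finite_subset)
    also have "\<dots> \<le> card (carrier G)" using A B by (intro card_mono) auto
    finally have "2 * (card near * card V) \<le> card (carrier G)" using cA cB by simp
    then have "2 * (real (card near) * real (card V)) \<le> real (card (carrier G))"
      by (metis of_nat_le_iff of_nat_mult of_nat_numeral)
    then show False using card_near by (simp add: n_def M_def mult_ac)
  qed
  then obtain h1 v1 h2 v2 where *: "h1 \<in> near" "v1 \<in> V" "h2 \<in> near" "v2 \<in> V"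
    and eq: "h1 \<otimes> v1 = g \<otimes> inv (h2 \<otimes> v2)"
    by (auto simp: A_def B_def)
  note c = *(1,3)[THEN near] *(2,4)[THEN V_carrier]
  show ?thesis
  proof
    show "h1 \<otimes> h2 \<in> stabiliser"
      using disp_mult[OF c(1,2)] disp_near[OF *(1)] disp_near[OF *(3)] c by (simp add: stabiliser_def)
    show "inv h2 \<otimes> v1 \<otimes> h2 \<otimes> v2 \<in> V"
      using c * by (intro V_mult V_conj) auto
    have "g = (h1 \<otimes> v1) \<otimes> (h2 \<otimes> v2)" unfolding eq using c g by (simp add: m_assoc)
    also have "\<dots> = h1 \<otimes> h2 \<otimes> (inv h2 \<otimes> v1 \<otimes> h2 \<otimes> v2)"
    proof -
      have "h2 \<otimes> (inv h2 \<otimes> (v1 \<otimes> (h2 \<otimes> v2))) = v1 \<otimes> (h2 \<otimes> v2)"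
        using c by (simp add: m_assoc[symmetric])
      then show ?thesis using c by (simp add: m_assoc)
    qed
    finally show "g = h1 \<otimes> h2 \<otimes> (inv h2 \<otimes> v1 \<otimes> h2 \<otimes> v2)" .
  qed
qed

text \<open>For a product of two elements, choose an element of the set in the same coset of \<open>V\<close>; the two differ
  by an element of \<open>V\<close> that displaces \<open>u\<close> by at most three times a third of \<open>sqrt n\<close>, hence by one
  that is trivial.\<close>

lemma subgroup_stabiliser: "subgroup stabiliser G"
proof (rule subgroupI)
  show "stabiliser \<subseteq> carrier G" by (auto simp: stabiliser_def)
  have "disp \<one> = 0" by (simp add: disp_def L2_set_def)
  then show "stabiliser \<noteq> {}" using n_pos by (auto simp: stabiliser_def intro!: exI[of _ \<one>])
  show "inv g \<in> stabiliser" if "g \<in> stabiliser" for g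
    using that by (simp add: stabiliser_def disp_inv)
  show "g \<otimes> k \<in> stabiliser" if "g \<in> stabiliser" "k \<in> stabiliser" for g k
  proof -
    have c: "g \<in> carrier G" "k \<in> carrier G" using that by (auto simp: stabiliser_def)
    then have "g \<otimes> k \<in> carrier G" by simp
    then obtain l v where lv: "l \<in> stabiliser" "v \<in> V" "g \<otimes> k = l \<otimes> v"
      by (rule stabiliser_meets_cosets)
    have l: "l \<in> carrier G" using lv by (simp add: stabiliser_def)
    have "v = inv l \<otimes> (g \<otimes> k)"
      unfolding lv(3) using l V_carrier[OF lv(2)] by (simp add: m_assoc[symmetric])
    then have "disp v \<le> disp l + (disp g + disp k)"
      using disp_mult[of "inv l" "g \<otimes> k"] disp_mult[of g k] disp_inv[OF l] l c by simp
    also have "\<dots> \<le> sqrt n" using that lv(1) by (simp add: stabiliser_def)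
    finally have "v = \<one>" using lv(2) by (rule_tac V_trivial)
    then show ?thesis using lv l by simp
  qed
qed

theorem S_in_proper_coset: "in_proper_coset G S"
proof -
  obtain s where s: "s \<in> S" using S_nonempty by auto
  then have sc: "s \<in> carrier G" using S_carrier by auto
  have card: "0 < real (card S)"
    using S_nonempty finite_subset[OF S_carrier finite_carrier] by (simp add: card_gt_0_iff)
  have "t \<in> s <# stabiliser" if t: "t \<in> S" for t
  proof -
    have tc: "t \<in> carrier G" using t S_carrier by auto
    have "real (card S) * (disp (inv s \<otimes> t))\<^sup>2 \<le> 2 * spread S u"
      unfolding disp_sq by (rule displacement_le_spread[OF S_carrier s t])
    also have "\<dots> \<le> real (card S) * (n / 9)"
    proof -
      have "0 \<le> real (card S) * n" using n_pos by simp
      then show ?thesis using u_spread_card spread_nonneg[of S u] unfolding n_def by simp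
    qed
    finally have "(disp (inv s \<otimes> t))\<^sup>2 \<le> n / 9" using card by simp
    also have "\<dots> = (sqrt n / 3)\<^sup>2" using n_pos by (simp add: power_divide)
    finally have "disp (inv s \<otimes> t) \<le> sqrt n / 3" using n_pos by (rule_tac power2_le_imp_le) auto
    then have "inv s \<otimes> t \<in> stabiliser" using sc tc by (simp add: stabiliser_def)
    moreover have "t = s \<otimes> (inv s \<otimes> t)" using sc tc by (simp add: m_assoc[symmetric])
    ultimately show ?thesis unfolding l_coset_def by blast
  qed
  moreover have "stabiliser \<noteq> carrier G"
  proof
    assume eq: "stabiliser = carrier G"
    have "V \<noteq> {\<one>}" using M_ge_2 by (auto simp: M_def)
    then obtain v where v: "v \<in> V" "v \<noteq> \<one>" using V_one by auto
    then have "disp v \<le> sqrt n / 3" using eq V_carrier by (auto simp: stabiliser_def)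
    also have "\<dots> \<le> sqrt n" using n_pos by simp
    finally show False using V_trivial v by simp
  qed
  ultimately show ?thesis
    unfolding in_proper_coset_def using subgroup_stabiliser sc by blast
qed

end

section \<open>The spectral gap for functions on the group\<close>

context character_orbit
begin

text \<open>Otherwise \<open>f\<close>, rescaled to have mean square one and then projected to the unit disc, is a rigid
  function: its modulus has small spread and is invariant under \<open>V\<close>, so the gap makes it almost
  constant, and the projection does not increase the spread.\<close>

lemma average_equivariant_le:
  assumes S: "S \<subseteq> carrier G" "S \<noteq> {}" "\<not> in_proper_coset G S"
    and \<rho>: "0 \<le> \<rho>" "\<rho> < 1" "contracts_invariant S \<rho>"
    and \<chi>: "\<chi> \<in> X" "\<chi> \<noteq> triv"
    and f: "\<And>g v. g \<in> carrier G \<Longrightarrow> v \<in> V \<Longrightarrow> f (g \<otimes> v) = \<chi> v * f g"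
  shows "energy (average S f) \<le> (1 - min (1 - \<rho>) (1 / card S) / 10^8)\<^sup>2 * energy f"
proof (rule ccontr)
  define n k \<mu> E where "n = real (card (carrier G))" and "k = real (card S)"
    and "\<mu> = min (1 - \<rho>) (1 / k)" and "E = energy f"
  assume "\<not> ?thesis"
  then have gt: "(1 - \<mu> / 10^8)\<^sup>2 * E < energy (average S f)"
    by (simp add: \<mu>_def k_def E_def)
  have n: "0 < n" using order_pos by (simp add: n_def)
  have k: "0 < k"
    using S finite_subset[OF S(1) finite_carrier] by (simp add: k_def card_gt_0_iff)
  have \<mu>: "0 < \<mu>" "\<mu> \<le> 1 - \<rho>" "\<mu> \<le> 1 / k" using \<rho> k by (auto simp: \<mu>_def)
  have E: "0 < E"
  proof (rule ccontr)
    assume "\<not> 0 < E"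
    then have "E = 0" using energy_nonneg[of f] by (simp add: E_def)
    then show False using gt energy_average_le[OF S(1), of f] by (simp add: E_def)
  qed
  define f' where "f' = (\<lambda>g. of_real (sqrt (n / E)) * f g)"
  have E': "energy f' = n"
    using n E by (simp add: f'_def energy_scale E_def)
  have "average S f' = (\<lambda>g. of_real (sqrt (n / E)) * average S f g)"
    by (simp add: average_def f'_def sum_distrib_left fun_eq_iff)
  then have avg': "energy (average S f') = n / E * energy (average S f)"
    using n E by (simp add: energy_scale)
  have "n / E * ((1 - \<mu> / 10^8)\<^sup>2 * E) \<le> n / E * energy (average S f)"
    using gt n E by (intro mult_left_mono) auto
  then have "(1 - \<mu> / 10^8)\<^sup>2 * n \<le> energy (average S f')"
    unfolding avg' using E by (simp add: mult.commute)
  moreover have "(1 - 2 * (\<mu> / 10^8)) * n \<le> (1 - \<mu> / 10^8)\<^sup>2 * n"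
    using n by (intro mult_right_mono) (auto simp: power2_eq_square algebra_simps)
  ultimately have "energy f' - energy (average S f') \<le> 2 * (\<mu> / 10^8) * n"
    unfolding E' by (simp add: algebra_simps)
  then have "2 * k\<^sup>2 * (energy f' - energy (average S f')) \<le> 2 * k\<^sup>2 * (2 * (\<mu> / 10^8) * n)"
    by (intro mult_left_mono) auto
  then have spread': "spread S f' \<le> 4 * (k\<^sup>2 * \<mu> * n) / 10^8"
    unfolding spread_eq_energy_loss[OF S(1,2)] k_def by (simp add: mult_ac)
  define a where "a g = complex_of_real (norm (f' g))" for g
  define m where "m = (\<Sum>g\<in>carrier G. norm (f' g))"
  have Ea: "energy a = n" using E' by (simp add: a_def energy_def)
  have "norm (a g - a h) \<le> norm (f' g - f' h)" for g h
    unfolding a_def of_real_diff[symmetric] norm_of_real by (rule norm_triangle_ineq3)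
  then have "spread S a \<le> spread S f'" by (intro spread_mono S)
  moreover have "a (g \<otimes> v) = a g" if "g \<in> carrier G" "v \<in> V" for g v
    using that f char_norm[OF \<chi>(1)] by (simp add: a_def f'_def norm_mult)
  then have "2 * k\<^sup>2 * (1 - \<rho>) * (energy a - (norm (\<Sum>g\<in>carrier G. a g))\<^sup>2 / n) \<le> spread S a"
    unfolding k_def n_def by (rule variance_le_spread[OF S(1,2) \<rho>])
  moreover have "(norm (\<Sum>g\<in>carrier G. a g))\<^sup>2 = m\<^sup>2"
    unfolding a_def of_real_sum[symmetric] m_def[symmetric] by simp
  moreover have "4 * (k\<^sup>2 * \<mu> * n) / 10^8 \<le> 4 * (k\<^sup>2 * (1 - \<rho>) * n) / 10^8"
    using \<mu> n by (intro divide_right_mono mult_left_mono mult_right_mono) auto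
  ultimately have loss: "2 * k\<^sup>2 * (1 - \<rho>) * (n - m\<^sup>2 / n) \<le> 4 * (k\<^sup>2 * (1 - \<rho>) * n) / 10^8"
    using spread' unfolding Ea by simp
  have cancel: "P * Y \<le> P * (2 * n / 10^8)" if "2 * P * Y \<le> 4 * (P * n) / 10^8" for P Y
    using that by simp
  have "(k\<^sup>2 * (1 - \<rho>)) * (n - m\<^sup>2 / n) \<le> (k\<^sup>2 * (1 - \<rho>)) * (2 * n / 10^8)"
    by (rule cancel) (use loss in \<open>simp only: mult.assoc\<close>)
  then have "n - m\<^sup>2 / n \<le> 2 * n / 10^8"
    using k \<rho> by (simp only: mult_le_cancel_left_pos zero_less_power mult_pos_pos diff_gt_0_iff_gt)
  then have m2: "(1 - 2 / 10^8) * n\<^sup>2 \<le> m\<^sup>2"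
    using n by (simp add: field_simps power2_eq_square)
  have m: "(1 - 2 / 10^8) * n \<le> m"
  proof (cases "n \<le> m")
    case False
    then have "m * m \<le> n * m" using n by (intro mult_right_mono) (auto simp: m_def sum_nonneg)
    then have "n * ((1 - 2 / 10^8) * n) \<le> n * m" using m2 by (simp add: power2_eq_square)
    then show ?thesis using n by (simp only: mult_le_cancel_left_pos)
  qed (use n in simp)
  have "(\<Sum>g\<in>carrier G. (norm (f' g) - 1)\<^sup>2) = energy f' - 2 * m + n"
    by (simp add: power2_diff energy_def sum.distrib sum_subtractf m_def n_def sum_distrib_left)
  then have near1: "(\<Sum>g\<in>carrier G. (norm (f' g) - 1)\<^sup>2) \<le> 4 * n / 10^8"
    using m unfolding E' by simp
  define u where "u g = clip (f' g)" for g
  have mass: "(\<Sum>g\<in>carrier G. 1 - (norm (u g))\<^sup>2) \<le> n / 2500"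
  proof -
    \<comment> \<open>The arithmetic-geometric mean inequality, with the weight that balances a mean square of
      \<open>4 / 10^8\<close>: both terms contribute \<open>1/5000\<close>.\<close>
    have "1 - (norm (u g))\<^sup>2 \<le> 1/5000 + 5000 * (norm (f' g) - 1)\<^sup>2" for g
    proof -
      define x where "x = norm (f' g)"
      have "1 - (min 1 x)\<^sup>2 \<le> 1/5000 + 5000 * (x - 1)\<^sup>2"
      proof (cases "x \<le> 1")
        case True
        have "0 \<le> (5000 * (x - 1) + 1)\<^sup>2" by simp
        then have "2 * (1 - x) \<le> 1/5000 + 5000 * (x - 1)\<^sup>2"
          by (simp add: power2_eq_square algebra_simps)
        moreover have "1 - x\<^sup>2 \<le> 2 * (1 - x)"
          using zero_le_power2[of "1 - x"] by (simp add: power2_eq_square algebra_simps)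
        ultimately show ?thesis using True by (simp add: min_def)
      qed auto
      then show ?thesis by (simp add: u_def norm_clip x_def)
    qed
    then have "(\<Sum>g\<in>carrier G. 1 - (norm (u g))\<^sup>2)
        \<le> (\<Sum>g\<in>carrier G. 1/5000 + 5000 * (norm (f' g) - 1)\<^sup>2)"
      by (rule sum_mono)
    also have "\<dots> = n / 5000 + 5000 * (\<Sum>g\<in>carrier G. (norm (f' g) - 1)\<^sup>2)"
      by (simp add: sum.distrib sum_distrib_left n_def)
    also have "\<dots> \<le> n / 2500" using near1 by simp
    finally show ?thesis .
  qed
  have su: "spread S u \<le> 4 * (k\<^sup>2 * \<mu> * n) / 10^8"
    by (rule order_trans[OF spread_mono spread']) (auto simp: u_def clip_lipschitz S)
  have "rigid_function G V X S \<rho> \<chi> u"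
  proof (intro rigid_function.intro character_orbit_axioms rigid_function_axioms.intro S \<rho> \<chi>)
    show "norm (u g) \<le> 1" for g by (simp add: u_def norm_clip_le_1)
    show "u (g \<otimes> v) = \<chi> v * u g" if "g \<in> carrier G" "v \<in> V" for g v
    proof -
      have "f' (g \<otimes> v) = \<chi> v * f' g" using f[OF that] by (simp add: f'_def)
      then show ?thesis by (simp add: u_def clip_rotate char_norm[OF \<chi>(1) that(2)])
    qed
    show "(\<Sum>g\<in>carrier G. 1 - (norm (u g))\<^sup>2) \<le> card (carrier G) / 2500"
      using mass by (simp add: n_def)
    have weaken: "y \<le> Q / 10^7" if "0 \<le> Q" "y \<le> 4 * Q / 10^8" for y Q :: real
      using that by simp
    have su': "spread S u \<le> k\<^sup>2 * \<mu> * n / 10^7"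
      by (rule weaken[OF _ su]) (use k \<mu> n in simp)
    have "k\<^sup>2 * \<mu> * n \<le> k\<^sup>2 * (1 - \<rho>) * n"
      using \<mu> n by (intro mult_left_mono mult_right_mono) auto
    then show "spread S u \<le> (real (card S))\<^sup>2 * (1 - \<rho>) * card (carrier G) / 10^7"
      using su' by (simp add: k_def n_def)
    have "k\<^sup>2 * \<mu> * n \<le> k\<^sup>2 * (1 / k) * n"
      using \<mu> n by (intro mult_left_mono mult_right_mono) auto
    also have "\<dots> = k * n" using k by (simp add: power2_eq_square)
    finally show "spread S u \<le> real (card S) * card (carrier G) / 10^7"
      using su' by (simp add: k_def n_def)
  qed
  then have "in_proper_coset G S" by (rule rigid_function.S_in_proper_coset)
  then show False using S by simp
qed

definition isotypic :: "('a \<Rightarrow> complex) \<Rightarrow> ('a \<Rightarrow> complex) \<Rightarrow> 'a \<Rightarrow> complex" where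
  "isotypic \<psi> f g = (\<Sum>v\<in>V. cnj (\<psi> v) * f (g \<otimes> v)) / of_nat (card V)"

lemma isotypic_equivariant:
  assumes "\<psi> \<in> X" "g \<in> carrier G" "w \<in> V"
  shows "isotypic \<psi> f (g \<otimes> w) = \<psi> w * isotypic \<psi> f g"
proof -
  have w: "w \<in> carrier G" "inv w \<in> V" using assms V_carrier V_inv by auto
  have "(\<Sum>v\<in>V. cnj (\<psi> v) * f (g \<otimes> w \<otimes> v)) = (\<Sum>v\<in>V. cnj (\<psi> (inv w \<otimes> v)) * f (g \<otimes> w \<otimes> (inv w \<otimes> v)))"
    by (rule sum_V_translate[OF w(2), symmetric])
  also have "\<dots> = (\<Sum>v\<in>V. \<psi> w * (cnj (\<psi> v) * f (g \<otimes> v)))"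
  proof (rule sum.cong[OF refl])
    fix v assume v: "v \<in> V"
    have "g \<otimes> w \<otimes> (inv w \<otimes> v) = g \<otimes> (w \<otimes> (inv w \<otimes> v))"
      using assms w v V_carrier by (simp add: m_assoc)
    also have "w \<otimes> (inv w \<otimes> v) = v" using w v V_carrier by (simp add: m_assoc[symmetric])
    finally show "cnj (\<psi> (inv w \<otimes> v)) * f (g \<otimes> w \<otimes> (inv w \<otimes> v)) = \<psi> w * (cnj (\<psi> v) * f (g \<otimes> v))"
      using assms w v by (simp add: char_mult char_inv)
  qed
  finally show ?thesis by (simp add: isotypic_def sum_distrib_left)
qed

lemma sum_char_pair:
  assumes "v \<in> V" "w \<in> V"
  shows "(\<Sum>\<psi>\<in>X. cnj (\<psi> v) * \<psi> w) = (if v = w then of_nat (card V) else 0)"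
proof -
  have "(\<Sum>\<psi>\<in>X. cnj (\<psi> v) * \<psi> w) = (\<Sum>\<psi>\<in>X. \<psi> (inv v \<otimes> w))"
    using assms by (intro sum.cong refl) (simp add: char_mult char_inv V_inv)
  also have "\<dots> = (if v = w then of_nat (card V) else 0)"
  proof (cases "v = w")
    case True
    then show ?thesis using assms V_carrier by (simp add: char_one card_X)
  next
    case False
    then have "inv v \<otimes> w \<noteq> \<one>" using assms V_carrier by (metis inv_equality inv_inv inv_closed)
    then show ?thesis using False assms by (simp add: sum_X_eq_0 V_mult V_inv)
  qed
  finally show ?thesis .
qed

text \<open>Parseval's identity on each coset of \<open>V\<close>.\<close>

lemma sum_energy_isotypic: "(\<Sum>\<psi>\<in>X. energy (isotypic \<psi> f)) = energy f"
proof -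
  define M where "M = real (card V)"
  have M: "0 < M" using card_V_pos by (simp add: M_def)
  have pointwise: "(\<Sum>\<psi>\<in>X. (norm (isotypic \<psi> f g))\<^sup>2) = (\<Sum>v\<in>V. (norm (f (g \<otimes> v)))\<^sup>2) / M" for g
  proof -
    have "complex_of_real (\<Sum>\<psi>\<in>X. (norm (\<Sum>v\<in>V. cnj (\<psi> v) * f (g \<otimes> v)))\<^sup>2)
        = (\<Sum>\<psi>\<in>X. \<Sum>v\<in>V. \<Sum>w\<in>V. f (g \<otimes> v) * cnj (f (g \<otimes> w)) * (cnj (\<psi> v) * \<psi> w))"
      unfolding of_real_sum complex_norm_square cnj_sum sum_product
      by (intro sum.cong refl) (simp add: mult_ac)
    also have "\<dots> = (\<Sum>v\<in>V. \<Sum>w\<in>V. \<Sum>\<psi>\<in>X. f (g \<otimes> v) * cnj (f (g \<otimes> w)) * (cnj (\<psi> v) * \<psi> w))"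
      unfolding sum.swap[of _ V X] ..
    also have "\<dots> = (\<Sum>v\<in>V. \<Sum>w\<in>V. if v = w then of_real (M * (norm (f (g \<otimes> v)))\<^sup>2) else 0)"
    proof (intro sum.cong refl)
      fix v w assume "v \<in> V" "w \<in> V"
      then show "(\<Sum>\<psi>\<in>X. f (g \<otimes> v) * cnj (f (g \<otimes> w)) * (cnj (\<psi> v) * \<psi> w))
          = (if v = w then of_real (M * (norm (f (g \<otimes> v)))\<^sup>2) else 0)"
        unfolding sum_distrib_left[symmetric] of_real_mult complex_norm_square M_def
        by (simp add: sum_char_pair)
    qed
    also have "\<dots> = of_real (M * (\<Sum>v\<in>V. (norm (f (g \<otimes> v)))\<^sup>2))"
      by (simp add: finite_V sum_distrib_left)
    finally have "(\<Sum>\<psi>\<in>X. (norm (\<Sum>v\<in>V. cnj (\<psi> v) * f (g \<otimes> v)))\<^sup>2) = M * (\<Sum>v\<in>V. (norm (f (g \<otimes> v)))\<^sup>2)"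
      unfolding of_real_eq_iff .
    then show ?thesis
      using M by (simp add: isotypic_def norm_divide power_divide sum_divide_distrib[symmetric] M_def
          power2_eq_square)
  qed
  have "(\<Sum>\<psi>\<in>X. energy (isotypic \<psi> f)) = (\<Sum>g\<in>carrier G. \<Sum>\<psi>\<in>X. (norm (isotypic \<psi> f g))\<^sup>2)"
    unfolding energy_def by (rule sum.swap)
  also have "\<dots> = (\<Sum>v\<in>V. \<Sum>g\<in>carrier G. (norm (f (g \<otimes> v)))\<^sup>2) / M"
    unfolding pointwise sum_divide_distrib[symmetric] by (simp only: sum.swap[of _ V "carrier G"])
  also have "\<dots> = energy f"
    using M V_carrier sum_right_translate[where \<phi> = "\<lambda>g. (norm (f g))\<^sup>2"]
    by (simp add: energy_def M_def)
  finally show ?thesis .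
qed

lemma average_isotypic:
  assumes "S \<subseteq> carrier G" "g \<in> carrier G"
  shows "average S (isotypic \<psi> f) g = isotypic \<psi> (average S f) g"
proof -
  have "(\<Sum>s\<in>S. \<Sum>v\<in>V. cnj (\<psi> v) * f (inv s \<otimes> g \<otimes> v)) = (\<Sum>v\<in>V. \<Sum>s\<in>S. cnj (\<psi> v) * f (inv s \<otimes> g \<otimes> v))"
    by (rule sum.swap)
  also have "\<dots> = (\<Sum>v\<in>V. \<Sum>s\<in>S. cnj (\<psi> v) * f (inv s \<otimes> (g \<otimes> v)))"
    using assms V_carrier by (intro sum.cong refl) (auto simp: m_assoc subset_iff)
  finally show ?thesis
    by (simp add: average_def isotypic_def sum_divide_distrib[symmetric] sum_distrib_left[symmetric])
qed

theorem energy_average_le_gap: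
  assumes S: "S \<subseteq> carrier G" "S \<noteq> {}" "\<not> in_proper_coset G S"
    and \<rho>: "0 \<le> \<rho>" "\<rho> < 1" "contracts_invariant S \<rho>"
    and f: "(\<Sum>g\<in>carrier G. f g) = 0"
  shows "energy (average S f) \<le> (1 - min (1 - \<rho>) (1 / card S) / 10^8)\<^sup>2 * energy f"
proof -
  define q where "q = (1 - min (1 - \<rho>) (1 / card S) / 10^8)\<^sup>2"
  have "energy (average S (isotypic \<psi> f)) \<le> q * energy (isotypic \<psi> f)" if \<psi>: "\<psi> \<in> X" for \<psi>
  proof (cases "\<psi> = triv")
    case True
    have inv: "isotypic \<psi> f (g \<otimes> v) = isotypic \<psi> f g" if "g \<in> carrier G" "v \<in> V" for g v
      using isotypic_equivariant[OF \<psi> that] that True by simp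
    have "(\<Sum>g\<in>carrier G. isotypic \<psi> f g) = (\<Sum>v\<in>V. \<Sum>g\<in>carrier G. f (g \<otimes> v)) / of_nat (card V)"
      unfolding isotypic_def sum_divide_distrib[symmetric] sum.swap[of _ V] using True by simp
    also have "\<dots> = 0"
      using f V_carrier sum_right_translate[where \<phi> = f] by simp
    finally have "energy (average S (isotypic \<psi> f)) \<le> \<rho>\<^sup>2 * energy (isotypic \<psi> f)"
      using \<rho>(3) inv by (simp add: contracts_invariant_def)
    also have "\<dots> \<le> q * energy (isotypic \<psi> f)"
    proof -
      define \<mu> where "\<mu> = min (1 - \<rho>) (1 / real (card S))"
      have "0 \<le> \<mu>" "\<mu> \<le> 1 - \<rho>" using \<rho> by (auto simp: \<mu>_def)
      then have "\<rho> \<le> 1 - \<mu> / 10^8" by simp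
      then show ?thesis
        unfolding q_def \<mu>_def[symmetric] using \<rho> by (intro mult_right_mono power_mono energy_nonneg)
    qed
    finally show ?thesis .
  next
    case False
    show ?thesis
      unfolding q_def
      by (rule average_equivariant_le[OF S \<rho> \<psi> False isotypic_equivariant[OF \<psi>]])
  qed
  then have "(\<Sum>\<psi>\<in>X. energy (average S (isotypic \<psi> f))) \<le> (\<Sum>\<psi>\<in>X. q * energy (isotypic \<psi> f))"
    by (rule sum_mono)
  moreover have "energy (average S (isotypic \<psi> f)) = energy (isotypic \<psi> (average S f))" for \<psi>
    by (intro energy_cong average_isotypic S)
  ultimately show ?thesis
    by (simp add: sum_distrib_left[symmetric] sum_energy_isotypic q_def)
qed

end

section \<open>Operator norms and energies\<close>

context finite_group
begin

lemma l2_norm_eq: "l2_norm G f = sqrt (energy f)"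
  by (simp add: l2_norm_def L2_set_def energy_def)

lemma l2_norm_avg_op: "l2_norm G (avg_op G S f) = sqrt (energy (average S f))"
  unfolding l2_norm_eq by (intro arg_cong[where f = sqrt] energy_cong) (simp add: avg_op_def average_def)

lemma orthogonal_iff:
  "f \<in> orthogonal_to_constants G \<longleftrightarrow> f \<in> extensional (carrier G) \<and> (\<Sum>g\<in>carrier G. f g) = 0"
  by (auto simp: orthogonal_to_constants_def l2_inner_def sum_distrib_right[symmetric])

lemma avg_op0_norm_le:
  assumes "0 \<le> q"
    and "\<And>f. (\<Sum>g\<in>carrier G. f g) = 0 \<Longrightarrow> energy (average S f) \<le> q\<^sup>2 * energy f"
  shows "avg_op0_norm G S \<le> q"
  unfolding avg_op0_norm_def op_norm_on_def
proof (rule cSup_least)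
  have "(\<lambda>g\<in>carrier G. 0) \<in> orthogonal_to_constants G"
    by (simp add: orthogonal_iff)
  moreover have "l2_norm G (\<lambda>g\<in>carrier G. 0) \<le> 1"
    by (simp add: l2_norm_eq energy_def)
  ultimately show "{l2_norm G (avg_op G S f) | f. f \<in> orthogonal_to_constants G \<and> l2_norm G f \<le> 1} \<noteq> {}"
    by blast
next
  fix x assume "x \<in> {l2_norm G (avg_op G S f) | f. f \<in> orthogonal_to_constants G \<and> l2_norm G f \<le> 1}"
  then obtain f where "x = l2_norm G (avg_op G S f)" "f \<in> orthogonal_to_constants G" "l2_norm G f \<le> 1"
    by blast
  then have x: "x = sqrt (energy (average S f))" and f: "(\<Sum>g\<in>carrier G. f g) = 0"
    and e: "sqrt (energy f) \<le> 1"
    unfolding l2_norm_avg_op by (auto simp: orthogonal_iff l2_norm_eq)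
  have "energy (average S f) \<le> q\<^sup>2 * 1"
    using e by (intro order_trans[OF assms(2)[OF f]] mult_left_mono) auto
  then show "x \<le> q" unfolding x using assms(1) by (intro real_le_lsqrt) auto
qed

lemma avg_op0_norm_le_1: "S \<subseteq> carrier G \<Longrightarrow> avg_op0_norm G S \<le> 1"
  using energy_average_le by (intro avg_op0_norm_le) auto

lemma l2_norm_avg_op_le_avg_op0_norm:
  assumes S: "S \<subseteq> carrier G" and f: "f \<in> orthogonal_to_constants G" "l2_norm G f \<le> 1"
  shows "l2_norm G (avg_op G S f) \<le> avg_op0_norm G S"
  unfolding avg_op0_norm_def op_norm_on_def
proof (rule cSup_upper)
  show "bdd_above {l2_norm G (avg_op G S f) | f. f \<in> orthogonal_to_constants G \<and> l2_norm G f \<le> 1}"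
  proof (rule bdd_aboveI[where M = 1])
    fix x assume "x \<in> {l2_norm G (avg_op G S f) | f. f \<in> orthogonal_to_constants G \<and> l2_norm G f \<le> 1}"
    then obtain f where "x = l2_norm G (avg_op G S f)" "l2_norm G f \<le> 1"
      by blast
    then show "x \<le> 1"
      using order_trans[OF energy_average_le[OF S, of f]] unfolding l2_norm_avg_op
      by (simp add: l2_norm_eq)
  qed
qed (use f in blast)

lemma avg_op0_norm_nonneg:
  assumes "S \<subseteq> carrier G"
  shows "0 \<le> avg_op0_norm G S"
proof -
  have "0 \<le> l2_norm G (avg_op G S (\<lambda>g\<in>carrier G. 0))"
    unfolding l2_norm_avg_op by (simp add: energy_nonneg)
  also have "\<dots> \<le> avg_op0_norm G S"
    by (rule l2_norm_avg_op_le_avg_op0_norm[OF assms]) (simp_all add: orthogonal_iff l2_norm_eq energy_def)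
  finally show ?thesis .
qed

text \<open>The operator norm is a supremum over the unit ball of extensional functions of mean zero;
  rescaling and restricting extends its bound to all functions of mean zero.\<close>

lemma energy_average_le_avg_op0_norm:
  assumes S: "S \<subseteq> carrier G" and f: "(\<Sum>g\<in>carrier G. f g) = 0"
  shows "energy (average S f) \<le> (avg_op0_norm G S)\<^sup>2 * energy f"
proof (cases "energy f = 0")
  case True
  then show ?thesis using energy_average_le[OF S, of f] by simp
next
  case False
  define E where "E = energy f"
  have E: "0 < E" using False energy_nonneg[of f] by (simp add: E_def)
  define h where "h = (\<lambda>g\<in>carrier G. of_real (1 / sqrt E) * f g)"
  have "energy h = energy (\<lambda>g. of_real (1 / sqrt E) * f g)"
    by (intro energy_cong) (simp add: h_def)
  also have "\<dots> = 1"
    unfolding energy_scale using E by (simp add: power_divide norm_divide E_def)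
  finally have eh: "energy h = 1" .
  have "h \<in> orthogonal_to_constants G"
    using f by (simp add: h_def orthogonal_iff sum_divide_distrib[symmetric])
  then have le: "sqrt (energy (average S h)) \<le> avg_op0_norm G S"
    using l2_norm_avg_op_le_avg_op0_norm[OF S, of h] eh
    unfolding l2_norm_avg_op by (simp add: l2_norm_eq)
  have "energy (average S h) = energy (\<lambda>g. of_real (1 / sqrt E) * average S f g)"
    using S by (intro energy_cong) (auto simp: average_def h_def sum_divide_distrib[symmetric] subset_iff)
  also have "\<dots> = energy (average S f) / E"
    using E unfolding energy_scale by (simp add: power_divide norm_divide)
  finally have "energy (average S f) = E * energy (average S h)" using E by simp
  also have "\<dots> \<le> E * (avg_op0_norm G S)\<^sup>2"
    using le E energy_nonneg by (intro mult_left_mono) (auto dest: sqrt_le_D)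
  finally show ?thesis by (simp add: E_def mult.commute)
qed

lemma singleton_in_proper_coset:
  assumes "S \<subseteq> {s}" "s \<in> carrier G" "carrier G \<noteq> {\<one>}"
  shows "in_proper_coset G S"
  unfolding in_proper_coset_def l_coset_def
  using assms triv_subgroup by (intro exI[of _ "{\<one>}"] exI[of _ s]) auto

end

section \<open>The orbits of the special linear group on vectors\<close>

lemma finite_Fp_vecs: "finite (Fp_vecs d p)"
proof (rule finite_subset)
  show "Fp_vecs d p \<subseteq> vec d ` ({..<d} \<rightarrow>\<^sub>E {0..<int p})"
  proof
    fix v assume v: "v \<in> Fp_vecs d p"
    have "v = vec d (\<lambda>i\<in>{..<d}. v $ i)" using v by (auto simp: Fp_vecs_def)
    then show "v \<in> vec d ` ({..<d} \<rightarrow>\<^sub>E {0..<int p})"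
      by (rule image_eqI[where f = "vec d"]) (use v in \<open>auto simp: Fp_vecs_def\<close>)
  qed
qed (intro finite_imageI finite_PiE, auto)

lemma finite_Fp_mats: "finite (Fp_mats d p)"
proof (rule finite_subset)
  show "Fp_mats d p \<subseteq> mat d d ` (({..<d} \<times> {..<d}) \<rightarrow>\<^sub>E {0..<int p})"
  proof
    fix A assume A: "A \<in> Fp_mats d p"
    have "A = mat d d (\<lambda>ij\<in>{..<d} \<times> {..<d}. A $$ ij)" using A by (intro eq_matI) (auto simp: Fp_mats_def)
    then show "A \<in> mat d d ` (({..<d} \<times> {..<d}) \<rightarrow>\<^sub>E {0..<int p})"
      by (rule image_eqI[where f = "mat d d"]) (use A in \<open>auto simp: Fp_mats_def\<close>)
  qed
qed (intro finite_imageI finite_PiE, auto)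

text \<open>The action on vectors regarded as characters, which is by the transposed matrix.\<close>

definition reaches :: "nat \<Rightarrow> nat \<Rightarrow> int vec \<Rightarrow> int vec \<Rightarrow> bool" where
  "reaches d p \<xi> \<zeta> \<longleftrightarrow>
     (\<exists>B\<in>carrier (special_linear d p). \<zeta> = vec_mod p (transpose_mat B *\<^sub>v \<xi>))"

lemma transpose_mat_mod: "transpose_mat (mat_mod p C) = mat_mod p (transpose_mat C)"
  by (intro eq_matI) (auto simp: mat_mod_def)

lemma special_linear_carrier_mat: "A \<in> carrier (special_linear d p) \<Longrightarrow> A \<in> carrier_mat d d"
  by (auto simp: special_linear_def Fp_mats_def)

lemma vec_mod_transpose_mult:
  assumes "A \<in> carrier_mat d d" "B \<in> carrier_mat d d" "\<xi> \<in> carrier_vec d"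
  shows "vec_mod p (transpose_mat B *\<^sub>v vec_mod p (transpose_mat A *\<^sub>v \<xi>))
    = vec_mod p (transpose_mat (mat_mod p (A * B)) *\<^sub>v \<xi>)"
proof -
  have "vec_mod p (transpose_mat B *\<^sub>v vec_mod p (transpose_mat A *\<^sub>v \<xi>))
      = vec_mod p (transpose_mat B *\<^sub>v (transpose_mat A *\<^sub>v \<xi>))"
    using assms by (intro vec_mod_mult_right[of _ d d]) (auto intro!: mult_mat_vec_carrier)
  also have "transpose_mat B *\<^sub>v (transpose_mat A *\<^sub>v \<xi>) = transpose_mat (A * B) *\<^sub>v \<xi>"
    using assms by (simp add: transpose_mult[of _ d d] assoc_mult_mat_vec[of _ d d _ d])
  also have "vec_mod p \<dots> = vec_mod p (mat_mod p (transpose_mat (A * B)) *\<^sub>v \<xi>)"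
    using assms by (intro vec_mod_mult_left[symmetric, of _ d d]) auto
  finally show ?thesis by (simp add: transpose_mat_mod)
qed

lemma reaches_trans:
  assumes "prime p" "\<xi> \<in> Fp_vecs d p" "reaches d p \<xi> \<zeta>" "reaches d p \<zeta> \<omega>"
  shows "reaches d p \<xi> \<omega>"
proof -
  interpret group "special_linear d p" by (rule group_special_linear) fact
  obtain A B where A: "A \<in> carrier (special_linear d p)" "\<zeta> = vec_mod p (transpose_mat A *\<^sub>v \<xi>)"
    and B: "B \<in> carrier (special_linear d p)" "\<omega> = vec_mod p (transpose_mat B *\<^sub>v \<zeta>)"
    using assms(3,4) unfolding reaches_def by auto
  have "\<omega> = vec_mod p (transpose_mat (mat_mod p (A * B)) *\<^sub>v \<xi>)"
    unfolding B A using A B assms(2)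
    by (intro vec_mod_transpose_mult[of _ d]) (auto simp: special_linear_carrier_mat Fp_vecs_carrier)
  moreover have "mat_mod p (A * B) \<in> carrier (special_linear d p)"
    using m_closed[OF A(1) B(1)] by (simp add: special_linear_def)
  ultimately show ?thesis unfolding reaches_def by blast
qed

text \<open>A transvection adds a multiple of the \<open>i\<close>-th coordinate to the \<open>j\<close>-th; when the \<open>i\<close>-th
  coordinate is invertible, the \<open>j\<close>-th can be given any value.\<close>

lemma reaches_step:
  assumes p: "prime p" and \<xi>: "\<xi> \<in> Fp_vecs d p" and \<zeta>: "\<zeta> \<in> Fp_vecs d p"
    and ij: "i < d" "j < d" "i \<noteq> j" and nz: "\<xi> $ i \<noteq> 0"
    and agree: "\<And>k. k < d \<Longrightarrow> k \<noteq> j \<Longrightarrow> \<zeta> $ k = \<xi> $ k"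
  shows "reaches d p \<xi> \<zeta>"
proof -
  have p1: "1 < p" using p by (rule prime_gt_1_nat)
  have \<xi>i: "0 < \<xi> $ i" "\<xi> $ i < int p"
    using \<xi> ij nz by (force simp: Fp_vecs_def)+
  then have "\<not> int p dvd \<xi> $ i" by (auto dest: zdvd_imp_le)
  then have "coprime (int p) (\<xi> $ i)"
    using p by (intro prime_imp_coprime) auto
  then obtain a b where ab: "a * int p + b * \<xi> $ i = 1"
    using bezout_int[of "int p" "\<xi> $ i"] by auto
  define t where "t = b * (\<zeta> $ j - \<xi> $ j)"
  define B where "B = addrow_mat d t i j"
  have B: "B \<in> carrier_mat d d" by (simp add: B_def)
  have "det B = 1" unfolding B_def using ij by (intro det_addrow_mat) auto
  then have mem: "mat_mod p B \<in> carrier (special_linear d p)"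
    using p1 B by (simp add: special_linear_def mat_mod_in_Fp_mats det_mat_mod[of _ d])
  have tj: "(\<xi> $ j + t * \<xi> $ i) mod int p = \<zeta> $ j"
  proof -
    have "b * \<xi> $ i = 1 - a * int p" using ab by simp
    then have "t * \<xi> $ i = (1 - a * int p) * (\<zeta> $ j - \<xi> $ j)"
      by (simp add: t_def mult_ac)
    then have "\<xi> $ j + t * \<xi> $ i = \<zeta> $ j + int p * (- a * (\<zeta> $ j - \<xi> $ j))"
      by (simp add: algebra_simps)
    then have "(\<xi> $ j + t * \<xi> $ i) mod int p = \<zeta> $ j mod int p"
      by (simp only: mod_mult_self2)
    also have "\<dots> = \<zeta> $ j" using \<zeta> ij by (simp add: Fp_vecs_def)
    finally show ?thesis .
  qed
  have "\<zeta> = vec_mod p (transpose_mat B *\<^sub>v \<xi>)"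
  proof (rule eq_vecI)
    fix k assume "k < dim_vec (vec_mod p (transpose_mat B *\<^sub>v \<xi>))"
    then have k: "k < d" using B by simp
    have "(transpose_mat B *\<^sub>v \<xi>) $ k = (\<Sum>l\<in>{0..<d}. B $$ (l, k) * \<xi> $ l)"
      using k B \<xi> by (auto simp: scalar_prod_def Fp_vecs_def intro!: sum.cong)
    also have "\<dots> = (\<Sum>l\<in>{0..<d}. (if l = k then \<xi> $ l else 0) + (if l = i \<and> k = j then t * \<xi> $ l else 0))"
      using k ij by (intro sum.cong refl) (auto simp: B_def)
    also have "\<dots> = \<xi> $ k + (if k = j then t * \<xi> $ i else 0)"
      using k ij by (simp add: sum.distrib)
    finally have "vec_mod p (transpose_mat B *\<^sub>v \<xi>) $ k = (\<xi> $ k + (if k = j then t * \<xi> $ i else 0)) mod int p"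
      using k B by (simp add: vec_mod_def)
    also have "\<dots> = \<zeta> $ k"
      using tj agree[OF k] k \<xi> by (auto simp: Fp_vecs_def)
    finally show "\<zeta> $ k = vec_mod p (transpose_mat B *\<^sub>v \<xi>) $ k" by simp
  qed (use \<zeta> B in \<open>auto simp: Fp_vecs_def\<close>)
  also have "\<dots> = vec_mod p (transpose_mat (mat_mod p B) *\<^sub>v \<xi>)"
    unfolding transpose_mat_mod using B \<xi>
    by (intro vec_mod_mult_left[symmetric, of _ d d]) (auto simp: Fp_vecs_carrier)
  finally show ?thesis using mem unfolding reaches_def by blast
qed

text \<open>Every nonzero vector is connected with the all-ones vector: starting from a nonzero
  coordinate, change the other coordinates to one, and finally that coordinate itself.\<close>

lemma reaches_ones:
  assumes p: "prime p" and d: "2 \<le> d" and \<xi>: "\<xi> \<in> Fp_vecs d p" "\<xi> \<noteq> 0\<^sub>v d"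
  shows "reaches d p \<xi> (vec d (\<lambda>_. 1)) \<and> reaches d p (vec d (\<lambda>_. 1)) \<xi>"
proof -
  have p1: "1 < p" using p by (rule prime_gt_1_nat)
  have "dim_vec \<xi> = d" using \<xi> by (simp add: Fp_vecs_def)
  then obtain i where i: "i < d" "\<xi> $ i \<noteq> 0" using \<xi> by (metis eq_vecI index_zero_vec)
  define w where "w A = vec d (\<lambda>k. if k \<in> A then 1 else \<xi> $ k)" for A
  have w: "w A \<in> Fp_vecs d p" for A using \<xi> p1 by (auto simp: w_def Fp_vecs_def)
  have both: "reaches d p \<xi> (w A) \<and> reaches d p (w A) \<xi>" if "finite A" "A \<subseteq> {..<d} - {i}" for A
    using that
  proof (induction A rule: finite_induct)
    case empty
    obtain j where j: "j < d" "j \<noteq> i"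
      using d that[of 0] that[of 1] by (cases "i = 0") auto
    have "w {} = \<xi>" using \<xi> by (intro eq_vecI) (auto simp: w_def Fp_vecs_def)
    then show ?case using reaches_step[OF p \<xi>(1) \<xi>(1) i(1) j(1)] j i by auto
  next
    case (insert j A)
    then have j: "j < d" "j \<noteq> i" and A: "reaches d p \<xi> (w A)" "reaches d p (w A) \<xi>" and iA: "i \<notin> A"
      by auto
    have "reaches d p (w A) (w (insert j A))" "reaches d p (w (insert j A)) (w A)"
      by (rule reaches_step[OF p w w i(1) j(1)]; use i j iA in \<open>auto simp: w_def\<close>)+
    then show ?case
      using A reaches_trans[OF p \<xi>(1), of "w A" "w (insert j A)"]
        reaches_trans[OF p w, of "insert j A" "w A" \<xi>] by simp
  qed
  obtain j where j: "j < d" "j \<noteq> i"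
      using d that[of 0] that[of 1] by (cases "i = 0") auto
  have "vec d (\<lambda>_. 1) = w {..<d}" by (auto simp: w_def)
  moreover have "reaches d p (w ({..<d} - {i})) (w {..<d})" "reaches d p (w {..<d}) (w ({..<d} - {i}))"
    by (rule reaches_step[OF p w w j(1) i(1)]; use i j in \<open>auto simp: w_def\<close>)+
  moreover have "reaches d p \<xi> (w ({..<d} - {i}))" "reaches d p (w ({..<d} - {i})) \<xi>"
    using both[of "{..<d} - {i}"] by auto
  ultimately show ?thesis
    using reaches_trans[OF p \<xi>(1), of "w ({..<d} - {i})" "w {..<d}"]
      reaches_trans[OF p w, of "{..<d}" "w ({..<d} - {i})" \<xi>] by simp
qed

lemma reaches_nonzero:
  assumes p: "prime p" and d: "2 \<le> d"
    and \<xi>: "\<xi> \<in> Fp_vecs d p" "\<xi> \<noteq> 0\<^sub>v d" and \<zeta>: "\<zeta> \<in> Fp_vecs d p" "\<zeta> \<noteq> 0\<^sub>v d"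
  shows "reaches d p \<xi> \<zeta>"
  using reaches_trans[OF p] reaches_ones[OF p d] \<xi> \<zeta> by blast

section \<open>The affine special linear group\<close>

definition additive_char :: "nat \<Rightarrow> int \<Rightarrow> complex" where
  "additive_char p k = cis (2 * pi * (of_int k / of_nat p))"

lemma additive_char_add: "additive_char p (a + b) = additive_char p a * additive_char p b"
  by (simp add: additive_char_def cis_mult add_divide_distrib distrib_left)

lemma norm_additive_char: "norm (additive_char p k) = 1"
  by (simp add: additive_char_def)

lemma additive_char_0: "additive_char p 0 = 1"
  by (simp add: additive_char_def)

lemma additive_char_mod:
  assumes "0 < p"
  shows "additive_char p (k mod int p) = additive_char p k"
proof -
  have "additive_char p k = additive_char p (k mod int p + int p * (k div int p))" by simp
  also have "\<dots> = additive_char p (k mod int p) * additive_char p (int p * (k div int p))"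
    by (rule additive_char_add)
  also have "additive_char p (int p * (k div int p)) = cis (2 * pi * of_int (k div int p))"
    using assms by (simp add: additive_char_def)
  also have "\<dots> = 1" by (rule cis_multiple_2pi) simp
  finally show ?thesis by simp
qed

lemma additive_char_neq_1:
  assumes "0 < k" "k < int p"
  shows "additive_char p k \<noteq> 1"
proof
  assume "additive_char p k = 1"
  then have "cos (2 * pi * (real_of_int k / real p)) = 1"
    by (simp add: additive_char_def complex_eq_iff)
  then obtain m :: int where "2 * pi * (real_of_int k / real p) = of_int m * 2 * pi"
    unfolding cos_one_2pi_int by auto
  then have "real_of_int k = of_int m * real p"
    using assms by (simp add: field_simps)
  then have "k = m * int p" by (metis of_int_eq_iff of_int_mult of_int_of_nat_eq)
  then have "int p dvd k" by simp
  then show False using assms by (auto dest: zdvd_imp_le)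
qed

lemma additive_char_vec_mod:
  assumes "0 < p" "\<xi> \<in> carrier_vec d" "w \<in> carrier_vec d"
  shows "additive_char p (\<xi> \<bullet> vec_mod p w) = additive_char p (\<xi> \<bullet> w)"
    and "additive_char p (vec_mod p \<xi> \<bullet> w) = additive_char p (\<xi> \<bullet> w)"
proof -
  have "(\<xi> \<bullet> vec_mod p w) mod int p = (\<xi> \<bullet> w) mod int p"
    using assms by (simp add: scalar_prod_def vec_mod_def sum_mult_mod_right)
  then show "additive_char p (\<xi> \<bullet> vec_mod p w) = additive_char p (\<xi> \<bullet> w)"
    using additive_char_mod[OF assms(1)] by metis
  have "(vec_mod p \<xi> \<bullet> w) mod int p = (\<xi> \<bullet> w) mod int p"
    using assms by (simp add: scalar_prod_def vec_mod_def sum_mult_mod_left)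
  then show "additive_char p (vec_mod p \<xi> \<bullet> w) = additive_char p (\<xi> \<bullet> w)"
    using additive_char_mod[OF assms(1)] by metis
qed

definition translation_group :: "nat \<Rightarrow> nat \<Rightarrow> (int vec \<times> int mat) set" where
  "translation_group d p = Fp_vecs d p \<times> {1\<^sub>m d}"

definition translation_char :: "nat \<Rightarrow> nat \<Rightarrow> int vec \<Rightarrow> int vec \<times> int mat \<Rightarrow> complex" where
  "translation_char d p \<xi> = (\<lambda>g. if g \<in> translation_group d p then additive_char p (\<xi> \<bullet> fst g) else 0)"

locale affine_group =
  fixes d p :: nat
  assumes prime: "prime p"
begin

abbreviation "ASL \<equiv> affine_special_linear d p"
abbreviation "SL \<equiv> special_linear d p"

lemma p_gt_1: "1 < p"
  using prime by (rule prime_gt_1_nat)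

sublocale SL: finite_group SL
proof (intro finite_group.intro finite_group_axioms.intro group_special_linear prime)
  show "finite (carrier SL)"
    using finite_Fp_mats[of d p] by (simp add: special_linear_def)
qed

sublocale ASL: finite_group ASL
proof (intro finite_group.intro finite_group_axioms.intro group_affine_special_linear prime)
  show "finite (carrier ASL)"
    using finite_Fp_vecs[of d p] SL.finite_carrier by (simp add: affine_special_linear_def)
qed

lemma mem_ASL: "(v, A) \<in> carrier ASL \<longleftrightarrow> v \<in> Fp_vecs d p \<and> A \<in> carrier SL"
  by (simp add: affine_special_linear_def)

lemma carrier_ASL: "carrier ASL = Fp_vecs d p \<times> carrier SL"
  by (simp add: affine_special_linear_def)

lemma mult_ASL: "(v, A) \<otimes>\<^bsub>ASL\<^esub> (w, B) = (vec_mod p (v + A *\<^sub>v w), A \<otimes>\<^bsub>SL\<^esub> B)"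
  by (simp add: affine_special_linear_def)

lemma one_ASL: "\<one>\<^bsub>ASL\<^esub> = (0\<^sub>v d, \<one>\<^bsub>SL\<^esub>)"
  by (simp add: affine_special_linear_def)

lemma one_SL: "\<one>\<^bsub>SL\<^esub> = 1\<^sub>m d"
  by (simp add: special_linear_def)

lemma snd_mult: "snd (g \<otimes>\<^bsub>ASL\<^esub> h) = snd g \<otimes>\<^bsub>SL\<^esub> snd h"
  by (cases g, cases h) (simp add: mult_ASL)

lemma snd_closed: "g \<in> carrier ASL \<Longrightarrow> snd g \<in> carrier SL"
  by (cases g) (simp add: mem_ASL)

lemma snd_inv:
  assumes "g \<in> carrier ASL"
  shows "snd (inv\<^bsub>ASL\<^esub> g) = inv\<^bsub>SL\<^esub> (snd g)"
proof (rule SL.inv_equality[symmetric])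
  show "snd (inv\<^bsub>ASL\<^esub> g) \<otimes>\<^bsub>SL\<^esub> snd g = \<one>\<^bsub>SL\<^esub>"
    using assms by (simp add: snd_mult[symmetric] one_ASL)
qed (use assms snd_closed in auto)

lemma zero_vec: "0\<^sub>v d \<in> Fp_vecs d p"
  using p_gt_1 by (auto simp: Fp_vecs_def)

lemma mem_translation_group: "(v, A) \<in> translation_group d p \<longleftrightarrow> v \<in> Fp_vecs d p \<and> A = \<one>\<^bsub>SL\<^esub>"
  by (auto simp: translation_group_def one_SL)

lemma translation_group_carrier: "g \<in> translation_group d p \<Longrightarrow> g \<in> carrier ASL"
  by (cases g) (simp add: mem_translation_group mem_ASL)

lemma mult_vec_carrier: "A \<in> carrier SL \<Longrightarrow> v \<in> carrier_vec d \<Longrightarrow> A *\<^sub>v v \<in> carrier_vec d"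
  by (intro mult_mat_vec_carrier[of _ d d] special_linear_carrier_mat)

lemma translation_group_mult:
  assumes "v \<in> Fp_vecs d p" "w \<in> Fp_vecs d p"
  shows "(v, \<one>\<^bsub>SL\<^esub>) \<otimes>\<^bsub>ASL\<^esub> (w, \<one>\<^bsub>SL\<^esub>) = (vec_mod p (v + w), \<one>\<^bsub>SL\<^esub>)"
  using assms by (simp add: mult_ASL Fp_vecs_carrier one_SL[symmetric]) (simp add: one_SL Fp_vecs_carrier)

lemma conj_translation:
  assumes g: "g \<in> carrier ASL" and v: "v \<in> Fp_vecs d p"
  shows "inv\<^bsub>ASL\<^esub> g \<otimes>\<^bsub>ASL\<^esub> (v, \<one>\<^bsub>SL\<^esub>) \<otimes>\<^bsub>ASL\<^esub> g = (vec_mod p (inv\<^bsub>SL\<^esub> (snd g) *\<^sub>v v), \<one>\<^bsub>SL\<^esub>)"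
proof -
  obtain w B where gw: "g = (w, B)" by (cases g)
  obtain w' B' where ig: "inv\<^bsub>ASL\<^esub> g = (w', B')" by (cases "inv\<^bsub>ASL\<^esub> g")
  have B': "B' = inv\<^bsub>SL\<^esub> B" using snd_inv[OF g] gw ig by simp
  have c: "w \<in> carrier_vec d" "w' \<in> carrier_vec d" "v \<in> carrier_vec d" "B \<in> carrier SL" "B' \<in> carrier SL"
    using g v ASL.inv_closed[OF g] unfolding gw ig[unfolded gw] by (auto simp: mem_ASL Fp_vecs_carrier)
  note cm = mult_vec_carrier[OF c(5) c(1)] mult_vec_carrier[OF c(5) c(3)]
  have "inv\<^bsub>ASL\<^esub> g \<otimes>\<^bsub>ASL\<^esub> g = \<one>\<^bsub>ASL\<^esub>" using g by simp
  then have zero: "vec_mod p (w' + B' *\<^sub>v w) = 0\<^sub>v d" unfolding gw ig[unfolded gw] by (simp add: mult_ASL one_ASL)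
  have "inv\<^bsub>ASL\<^esub> g \<otimes>\<^bsub>ASL\<^esub> (v, \<one>\<^bsub>SL\<^esub>) \<otimes>\<^bsub>ASL\<^esub> g = (vec_mod p (vec_mod p (w' + B' *\<^sub>v v) + B' *\<^sub>v w), B' \<otimes>\<^bsub>SL\<^esub> B)"
    unfolding ig using c by (simp add: gw mult_ASL)
  also have "vec_mod p (vec_mod p (w' + B' *\<^sub>v v) + B' *\<^sub>v w) = vec_mod p ((w' + B' *\<^sub>v v) + B' *\<^sub>v w)"
    using c cm by (intro vec_mod_add_left) auto
  also have "(w' + B' *\<^sub>v v) + B' *\<^sub>v w = (w' + B' *\<^sub>v w) + B' *\<^sub>v v"
    using c cm by (intro eq_vecI) auto
  also have "vec_mod p \<dots> = vec_mod p (vec_mod p (w' + B' *\<^sub>v w) + B' *\<^sub>v v)"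
    using c cm by (intro vec_mod_add_left[symmetric]) auto
  also have "\<dots> = vec_mod p (B' *\<^sub>v v)"
    unfolding zero using cm by simp
  finally show ?thesis using c by (simp add: B' gw)
qed

text \<open>Conjugation by \<open>h\<close> acts on translations through the inverse of the linear part of \<open>h\<close>, and its
  transpose acts on characters.\<close>

lemma twist_translation_char:
  assumes h: "h \<in> carrier ASL" and \<xi>: "\<xi> \<in> Fp_vecs d p"
  shows "ASL.twist (translation_group d p) h (translation_char d p \<xi>)
    = translation_char d p (vec_mod p (transpose_mat (inv\<^bsub>SL\<^esub> (snd h)) *\<^sub>v \<xi>))"
proof
  fix g
  define B where "B = inv\<^bsub>SL\<^esub> (snd h)"
  have B: "B \<in> carrier SL" using snd_closed[OF h] by (simp add: B_def)
  have Bm: "B \<in> carrier_mat d d" by (rule special_linear_carrier_mat[OF B])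
  show "ASL.twist (translation_group d p) h (translation_char d p \<xi>) g
    = translation_char d p (vec_mod p (transpose_mat (inv\<^bsub>SL\<^esub> (snd h)) *\<^sub>v \<xi>)) g"
  proof (cases "g \<in> translation_group d p")
    case True
    then obtain v where g: "g = (v, \<one>\<^bsub>SL\<^esub>)" and v: "v \<in> Fp_vecs d p"
      by (cases g) (auto simp: mem_translation_group)
    have vc: "v \<in> carrier_vec d" "\<xi> \<in> carrier_vec d" using v \<xi> Fp_vecs_carrier by auto
    have Bv: "B *\<^sub>v v \<in> carrier_vec d" using B vc by (intro mult_vec_carrier)
    have mem: "(vec_mod p (B *\<^sub>v v), \<one>\<^bsub>SL\<^esub>) \<in> translation_group d p"
      using Bv p_gt_1 by (simp add: mem_translation_group vec_mod_in_Fp_vecs)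
    have "ASL.twist (translation_group d p) h (translation_char d p \<xi>) g = additive_char p (\<xi> \<bullet> vec_mod p (B *\<^sub>v v))"
      using True mem conj_translation[OF h v] by (simp add: ASL.twist_def translation_char_def g B_def)
    also have "\<dots> = additive_char p (\<xi> \<bullet> (B *\<^sub>v v))"
      using p_gt_1 vc Bv by (intro additive_char_vec_mod(1)) auto
    also have "\<xi> \<bullet> (B *\<^sub>v v) = (transpose_mat B *\<^sub>v \<xi>) \<bullet> v"
      by (rule transpose_vec_mult_scalar[OF Bm vc, symmetric])
    also have "additive_char p \<dots> = additive_char p (vec_mod p (transpose_mat B *\<^sub>v \<xi>) \<bullet> v)"
      using p_gt_1 vc Bm by (intro additive_char_vec_mod(2)[symmetric]) (auto intro!: mult_mat_vec_carrier)
    finally show ?thesis using True by (simp add: translation_char_def g B_def)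
  next
    case False
    then show ?thesis by (simp add: ASL.twist_def translation_char_def)
  qed
qed

lemma translation_char_zero:
  "translation_char d p (0\<^sub>v d) = (\<lambda>g. if g \<in> translation_group d p then 1 else 0)"
  by (auto simp: translation_char_def translation_group_def Fp_vecs_def additive_char_0)

lemma vec_mod_transpose_in_Fp_vecs:
  assumes "B \<in> carrier SL" "\<xi> \<in> Fp_vecs d p"
  shows "vec_mod p (transpose_mat B *\<^sub>v \<xi>) \<in> Fp_vecs d p"
  using assms p_gt_1 special_linear_carrier_mat[OF assms(1)] Fp_vecs_carrier[OF assms(2)]
  by (intro vec_mod_in_Fp_vecs mult_mat_vec_carrier[of _ d d]) auto

lemma character_orbit_translation_group:
  assumes d: "2 \<le> d"
  shows "character_orbit ASL (translation_group d p) (translation_char d p ` Fp_vecs d p)"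
proof (intro character_orbit.intro character_orbit_axioms.intro ASL.finite_group_axioms)
  have p0: "0 < p" using p_gt_1 by simp
  show "subgroup (translation_group d p) ASL"
  proof (rule ASL.subgroupI)
    show "translation_group d p \<subseteq> carrier ASL" using translation_group_carrier by auto
    show "translation_group d p \<noteq> {}" using zero_vec by (auto simp: translation_group_def)
    show "g \<otimes>\<^bsub>ASL\<^esub> h \<in> translation_group d p" if "g \<in> translation_group d p" "h \<in> translation_group d p" for g h
      using that p0 by (cases g, cases h)
        (auto simp: mem_translation_group translation_group_mult Fp_vecs_carrier intro!: vec_mod_in_Fp_vecs)
    show "inv\<^bsub>ASL\<^esub> g \<in> translation_group d p" if g: "g \<in> translation_group d p" for g
    proof -
      have "snd (inv\<^bsub>ASL\<^esub> g) = \<one>\<^bsub>SL\<^esub>"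
        using snd_inv[OF translation_group_carrier[OF g]] g by (cases g) (simp add: mem_translation_group)
      moreover have "fst (inv\<^bsub>ASL\<^esub> g) \<in> Fp_vecs d p"
        using ASL.inv_closed[OF translation_group_carrier[OF g]] by (cases "inv\<^bsub>ASL\<^esub> g") (simp add: mem_ASL)
      ultimately show ?thesis by (cases "inv\<^bsub>ASL\<^esub> g") (simp add: mem_translation_group)
    qed
  qed
  show "inv\<^bsub>ASL\<^esub> g \<otimes>\<^bsub>ASL\<^esub> v \<otimes>\<^bsub>ASL\<^esub> g \<in> translation_group d p"
    if "g \<in> carrier ASL" "v \<in> translation_group d p" for g v
    using that p0 mult_vec_carrier[OF SL.inv_closed[OF snd_closed[OF that(1)]]]
    by (cases v) (auto simp: mem_translation_group conj_translation Fp_vecs_carrier intro!: vec_mod_in_Fp_vecs)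
  show "finite (translation_char d p ` Fp_vecs d p)" by (intro finite_imageI finite_Fp_vecs)
  show "(\<lambda>g. if g \<in> translation_group d p then 1 else 0) \<in> translation_char d p ` Fp_vecs d p"
    unfolding translation_char_zero[symmetric] by (intro imageI zero_vec)
  show "\<psi> (g \<otimes>\<^bsub>ASL\<^esub> h) = \<psi> g * \<psi> h"
    if \<psi>: "\<psi> \<in> translation_char d p ` Fp_vecs d p" and gh: "g \<in> translation_group d p" "h \<in> translation_group d p" for \<psi> g h
  proof -
    obtain \<xi> where \<xi>: "\<xi> \<in> Fp_vecs d p" "\<psi> = translation_char d p \<xi>" using \<psi> by auto
    obtain v w where vw: "g = (v, \<one>\<^bsub>SL\<^esub>)" "h = (w, \<one>\<^bsub>SL\<^esub>)" "v \<in> Fp_vecs d p" "w \<in> Fp_vecs d p"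
      using gh by (cases g, cases h) (auto simp: mem_translation_group)
    note c = vw(3,4)[THEN Fp_vecs_carrier] Fp_vecs_carrier[OF \<xi>(1)]
    have "vec_mod p (v + w) \<in> Fp_vecs d p" using c p0 by (intro vec_mod_in_Fp_vecs) auto
    then have "\<psi> (g \<otimes>\<^bsub>ASL\<^esub> h) = additive_char p (\<xi> \<bullet> vec_mod p (v + w))"
      unfolding vw(1,2) translation_group_mult[OF vw(3,4)] by (simp add: \<xi>(2) translation_char_def mem_translation_group)
    also have "\<dots> = additive_char p (\<xi> \<bullet> v + \<xi> \<bullet> w)"
      using c p0 by (simp add: additive_char_vec_mod(1)[of _ _ d] scalar_prod_add_distrib[of _ d])
    also have "\<dots> = \<psi> g * \<psi> h"
      using gh by (simp add: additive_char_add \<xi>(2) translation_char_def vw(1,2))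
    finally show ?thesis .
  qed
  show "norm (\<psi> g) = 1" if "\<psi> \<in> translation_char d p ` Fp_vecs d p" "g \<in> translation_group d p" for \<psi> g
    using that by (auto simp: translation_char_def norm_additive_char)
  show "\<psi> g = 0" if "\<psi> \<in> translation_char d p ` Fp_vecs d p" "g \<notin> translation_group d p" for \<psi> g
    using that by (auto simp: translation_char_def)
  show "(\<lambda>g. \<psi> g * \<phi> g) \<in> translation_char d p ` Fp_vecs d p"
    if \<psi>\<phi>: "\<psi> \<in> translation_char d p ` Fp_vecs d p" "\<phi> \<in> translation_char d p ` Fp_vecs d p" for \<psi> \<phi>
  proof -
    obtain \<xi> \<zeta> where *: "\<xi> \<in> Fp_vecs d p" "\<psi> = translation_char d p \<xi>"
      "\<zeta> \<in> Fp_vecs d p" "\<phi> = translation_char d p \<zeta>" using \<psi>\<phi> by auto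
    note c = *(1,3)[THEN Fp_vecs_carrier]
    have "(\<lambda>g. \<psi> g * \<phi> g) = translation_char d p (vec_mod p (\<xi> + \<zeta>))"
    proof
      fix g
      show "\<psi> g * \<phi> g = translation_char d p (vec_mod p (\<xi> + \<zeta>)) g"
      proof (cases "g \<in> translation_group d p")
        case True
        then have "fst g \<in> carrier_vec d" by (auto simp: translation_group_def Fp_vecs_carrier)
        then show ?thesis using c p0 True
          by (simp add: *(2,4) translation_char_def additive_char_vec_mod(2)[of _ _ d]
              add_scalar_prod_distrib[of _ d] additive_char_add)
      qed (simp add: *(2,4) translation_char_def)
    qed
    moreover have "vec_mod p (\<xi> + \<zeta>) \<in> Fp_vecs d p" using c p0 by (intro vec_mod_in_Fp_vecs) auto
    ultimately show ?thesis by blast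
  qed
  show "ASL.twist (translation_group d p) h \<psi> \<in> translation_char d p ` Fp_vecs d p"
    if \<psi>: "\<psi> \<in> translation_char d p ` Fp_vecs d p" and h: "h \<in> carrier ASL" for \<psi> h
    using \<psi> twist_translation_char[OF h] vec_mod_transpose_in_Fp_vecs[OF SL.inv_closed[OF snd_closed[OF h]]]
    by auto
  show "\<exists>\<psi>\<in>translation_char d p ` Fp_vecs d p. \<psi> g \<noteq> 1"
    if g: "g \<in> translation_group d p" "g \<noteq> \<one>\<^bsub>ASL\<^esub>" for g
  proof -
    obtain v where v: "g = (v, \<one>\<^bsub>SL\<^esub>)" "v \<in> Fp_vecs d p" using g by (cases g) (auto simp: mem_translation_group)
    then have "v \<noteq> 0\<^sub>v d" using g by (auto simp: one_ASL)
    moreover have "dim_vec v = d" using v by (simp add: Fp_vecs_def)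
    ultimately obtain i where i: "i < d" "v $ i \<noteq> 0" by (metis eq_vecI index_zero_vec)
    have vi: "0 < v $ i" "v $ i < int p" using v i by (force simp: Fp_vecs_def)+
    have "translation_char d p (unit_vec d i) g = additive_char p (v $ i)"
      using g i v Fp_vecs_carrier by (simp add: translation_char_def)
    moreover have "unit_vec d i \<in> Fp_vecs d p" using p_gt_1 by (auto simp: Fp_vecs_def unit_vec_def)
    ultimately show ?thesis using additive_char_neq_1[OF vi] by (metis imageI)
  qed
  show "\<exists>h\<in>carrier ASL. \<phi> = ASL.twist (translation_group d p) h \<psi>"
    if \<psi>: "\<psi> \<in> translation_char d p ` Fp_vecs d p" and \<phi>: "\<phi> \<in> translation_char d p ` Fp_vecs d p"
      and nontriv: "\<psi> \<noteq> (\<lambda>g. if g \<in> translation_group d p then 1 else 0)"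
        "\<phi> \<noteq> (\<lambda>g. if g \<in> translation_group d p then 1 else 0)" for \<psi> \<phi>
  proof -
    obtain \<xi> \<zeta> where *: "\<xi> \<in> Fp_vecs d p" "\<psi> = translation_char d p \<xi>"
      "\<zeta> \<in> Fp_vecs d p" "\<phi> = translation_char d p \<zeta>" using \<psi> \<phi> by auto
    have "\<xi> \<noteq> 0\<^sub>v d" "\<zeta> \<noteq> 0\<^sub>v d" using nontriv * translation_char_zero by auto
    then obtain B where B: "B \<in> carrier SL" "\<zeta> = vec_mod p (transpose_mat B *\<^sub>v \<xi>)"
      using reaches_nonzero[OF prime d] * unfolding reaches_def by blast
    have h: "(0\<^sub>v d, inv\<^bsub>SL\<^esub> B) \<in> carrier ASL" using B zero_vec by (simp add: mem_ASL)
    have "ASL.twist (translation_group d p) (0\<^sub>v d, inv\<^bsub>SL\<^esub> B) \<psi> = \<phi>"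
      unfolding *(2,4) twist_translation_char[OF h *(1)] using B by simp
    then show ?thesis using h by blast
  qed
qed

text \<open>A function on the group that does not see translations is a function of the linear part, and
  averaging over \<open>S\<close> becomes averaging over the linear parts.\<close>

lemma contracts_invariant_linear_part:
  assumes orbit: "character_orbit ASL (translation_group d p) X"
    and S': "S' \<subseteq> carrier SL" and S: "S \<subseteq> carrier ASL" and bij: "bij_betw snd S S'"
  shows "character_orbit.contracts_invariant ASL (translation_group d p) S (avg_op0_norm SL S')"
  unfolding character_orbit.contracts_invariant_def[OF orbit]
proof (intro allI impI)
  fix \<phi> :: "int vec \<times> int mat \<Rightarrow> complex"
  assume inv: "\<forall>g\<in>carrier ASL. \<forall>v\<in>translation_group d p. \<phi> (g \<otimes>\<^bsub>ASL\<^esub> v) = \<phi> g"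
    and sum0: "(\<Sum>g\<in>carrier ASL. \<phi> g) = 0"
  define \<phi>' where "\<phi>' A = \<phi> (0\<^sub>v d, A)" for A
  define M where "M = real (card (Fp_vecs d p))"
  have M: "0 < M" using zero_vec finite_Fp_vecs by (auto simp: M_def card_gt_0_iff)
  have eq: "\<phi> g = \<phi>' (snd g)" if g: "g \<in> carrier ASL" for g
  proof -
    obtain v A where gA: "g = (v, A)" by (cases g)
    have v: "v \<in> Fp_vecs d p" and A: "A \<in> carrier SL" using g by (auto simp: gA mem_ASL)
    have c: "(0\<^sub>v d, A) \<in> carrier ASL" using A zero_vec by (simp add: mem_ASL)
    have t: "(v, \<one>\<^bsub>SL\<^esub>) \<in> translation_group d p" using v by (simp add: mem_translation_group)
    have "g = (v, \<one>\<^bsub>SL\<^esub>) \<otimes>\<^bsub>ASL\<^esub> (0\<^sub>v d, A)"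
      using v A Fp_vecs_carrier[OF v] by (simp add: gA mult_ASL vec_mod_id one_SL[symmetric])
        (simp add: one_SL vec_mod_id)
    also have "\<dots> = (0\<^sub>v d, A) \<otimes>\<^bsub>ASL\<^esub> (inv\<^bsub>ASL\<^esub> (0\<^sub>v d, A) \<otimes>\<^bsub>ASL\<^esub> (v, \<one>\<^bsub>SL\<^esub>) \<otimes>\<^bsub>ASL\<^esub> (0\<^sub>v d, A))"
      using c translation_group_carrier[OF t] by (simp add: ASL.m_assoc) (simp add: ASL.m_assoc[symmetric])
    finally have "\<phi> g = \<phi> \<dots>" by (rule arg_cong)
    also have "\<dots> = \<phi> (0\<^sub>v d, A)"
      using inv c character_orbit.V_conj[OF orbit c t] by blast
    finally show ?thesis by (simp add: \<phi>'_def gA)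
  qed
  have sums: "(\<Sum>g\<in>carrier ASL. F (snd g)) = of_real M * (\<Sum>A\<in>carrier SL. F A)" for F :: "int mat \<Rightarrow> complex"
    unfolding carrier_ASL using sum.cartesian_product[of "\<lambda>v A. F A" "carrier SL" "Fp_vecs d p"]
    by (simp add: M_def split_def)
  have energies: "ASL.energy (\<lambda>g. F (snd g)) = M * SL.energy F" for F
    unfolding ASL.energy_def SL.energy_def carrier_ASL
    using sum.cartesian_product[of "\<lambda>v A. (norm (F A))\<^sup>2" "carrier SL" "Fp_vecs d p"]
    by (simp add: M_def split_def)
  have "(\<Sum>g\<in>carrier ASL. \<phi> g) = (\<Sum>g\<in>carrier ASL. \<phi>' (snd g))"
    by (intro sum.cong refl eq)
  then have "of_real M * (\<Sum>A\<in>carrier SL. \<phi>' A) = 0"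
    using sum0 sums[of \<phi>'] by simp
  then have "(\<Sum>A\<in>carrier SL. \<phi>' A) = 0" using M by simp
  then have le: "SL.energy (SL.average S' \<phi>') \<le> (avg_op0_norm SL S')\<^sup>2 * SL.energy \<phi>'"
    by (rule SL.energy_average_le_avg_op0_norm[OF S'])
  have "ASL.average S \<phi> g = SL.average S' \<phi>' (snd g)" if g: "g \<in> carrier ASL" for g
  proof -
    have "(\<Sum>s\<in>S. \<phi> (inv\<^bsub>ASL\<^esub> s \<otimes>\<^bsub>ASL\<^esub> g)) = (\<Sum>s\<in>S. \<phi>' (inv\<^bsub>SL\<^esub> (snd s) \<otimes>\<^bsub>SL\<^esub> snd g))"
      using S g by (intro sum.cong refl) (auto simp: eq snd_mult snd_inv subset_iff)
    also have "\<dots> = (\<Sum>\<theta>\<in>S'. \<phi>' (inv\<^bsub>SL\<^esub> \<theta> \<otimes>\<^bsub>SL\<^esub> snd g))"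
      by (rule sum.reindex_bij_betw[OF bij])
    finally show ?thesis
      by (simp add: ASL.average_def SL.average_def bij_betw_same_card[OF bij])
  qed
  then have "ASL.energy (ASL.average S \<phi>) = M * SL.energy (SL.average S' \<phi>')"
    unfolding energies[symmetric] by (rule ASL.energy_cong)
  also have "\<dots> \<le> M * ((avg_op0_norm SL S')\<^sup>2 * SL.energy \<phi>')"
    using le M by (intro mult_left_mono) auto
  also have "\<dots> = (avg_op0_norm SL S')\<^sup>2 * ASL.energy \<phi>"
    using energies[of \<phi>'] ASL.energy_cong[OF eq] by simp
  finally show "ASL.energy (ASL.average S \<phi>) \<le> (avg_op0_norm SL S')\<^sup>2 * ASL.energy \<phi>" .
qed

lemma carrier_SL_1: "carrier (special_linear 1 p) \<subseteq> {1\<^sub>m 1}"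
proof
  fix A assume "A \<in> carrier (special_linear 1 p)"
  then have A: "A \<in> carrier_mat 1 1" "A $$ (0, 0) \<in> {0..<int p}" "det A mod int p = 1 mod int p"
    by (auto simp: special_linear_def Fp_mats_def)
  have "A $$ (0, 0) = 1" using A p_gt_1 by (simp add: det_single)
  then show "A \<in> {1\<^sub>m 1}" using A by (auto intro!: eq_matI)
qed

lemma ASL_nontrivial:
  assumes "1 \<le> d"
  shows "carrier ASL \<noteq> {\<one>\<^bsub>ASL\<^esub>}"
proof
  assume eq: "carrier ASL = {\<one>\<^bsub>ASL\<^esub>}"
  have "unit_vec d 0 \<in> Fp_vecs d p" using p_gt_1 by (auto simp: Fp_vecs_def unit_vec_def)
  then have "(unit_vec d 0, \<one>\<^bsub>SL\<^esub>) \<in> carrier ASL" by (simp add: mem_ASL)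
  then have "unit_vec d 0 = (0\<^sub>v d :: int vec)" using eq by (simp add: one_ASL)
  then have "unit_vec d 0 $ 0 = (0\<^sub>v d :: int vec) $ 0" by simp
  then show False using assms by simp
qed

text \<open>If the linear parts have no gap, the bound says no more than that averaging is a contraction.\<close>

lemma spectral_gap:
  assumes d: "1 \<le> d" and S': "S' \<subseteq> carrier SL" and S: "S \<subseteq> carrier ASL" and bij: "bij_betw snd S S'"
    and coset: "\<not> in_proper_coset ASL S"
  shows "1 / 10^8 * min (1 - avg_op0_norm SL S') (1 / real (card S)) \<le> 1 - avg_op0_norm ASL S"
proof -
  define \<rho> where "\<rho> = avg_op0_norm SL S'"
  define \<mu> where "\<mu> = min (1 - \<rho>) (1 / real (card S))"
  have not_single: "\<not> S \<subseteq> {s}" if "s \<in> carrier ASL" for s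
    using coset ASL.singleton_in_proper_coset[OF _ that ASL_nontrivial[OF d]] by auto
  have "d \<noteq> 1"
  proof
    assume d1: "d = 1"
    obtain s where s: "s \<in> S" using not_single[OF ASL.one_closed] by auto
    have "t = s" if "t \<in> S" for t
      using that s bij S' carrier_SL_1 unfolding d1 bij_betw_def
      by (metis imageI inj_onD singletonD subsetD)
    then have "S \<subseteq> {s}" by auto
    then show False using not_single[OF subsetD[OF S s]] by simp
  qed
  then have d2: "2 \<le> d" using d by simp
  interpret character_orbit ASL "translation_group d p" "translation_char d p ` Fp_vecs d p"
    by (rule character_orbit_translation_group[OF d2])
  have ne: "S \<noteq> {}" using not_single[OF ASL.one_closed] by auto
  have le1: "avg_op0_norm ASL S \<le> 1" by (rule ASL.avg_op0_norm_le_1[OF S])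
  show ?thesis
  proof (cases "\<rho> < 1")
    case True
    have \<rho>0: "0 \<le> \<rho>" unfolding \<rho>_def by (rule SL.avg_op0_norm_nonneg[OF S'])
    have con: "contracts_invariant S \<rho>"
      unfolding \<rho>_def by (rule contracts_invariant_linear_part[OF character_orbit_axioms S' S bij])
    have "\<mu> \<le> 1" using \<rho>0 by (simp add: \<mu>_def)
    then have "0 \<le> 1 - \<mu> / 10^8" by simp
    then have "avg_op0_norm ASL S \<le> 1 - \<mu> / 10^8"
      unfolding \<mu>_def
      by (rule ASL.avg_op0_norm_le) (rule energy_average_le_gap[OF S ne coset \<rho>0 True con])
    then show ?thesis by (simp add: \<mu>_def \<rho>_def)
  next
    case False
    then have "min (1 - \<rho>) (1 / real (card S)) \<le> 0" by (simp add: min.coboundedI1)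
    then show ?thesis using le1 unfolding \<rho>_def[symmetric] by simp
  qed
qed

end

theorem theorem1:
  fixes d :: nat
  assumes "d \<ge> 1"
  shows "\<exists>c>0::real. \<forall>p::nat. prime p \<longrightarrow>
    (\<forall>S' S. S' \<subseteq> carrier (special_linear d p) \<longrightarrow>
      S \<subseteq> carrier (affine_special_linear d p) \<longrightarrow>
      bij_betw snd S S' \<longrightarrow>
      \<not> in_proper_coset (affine_special_linear d p) S \<longrightarrow>
      1 - avg_op0_norm (affine_special_linear d p) S
        \<ge> c * min (1 - avg_op0_norm (special_linear d p) S') (1 / real (card S)))"
  using affine_group.spectral_gap[OF affine_group.intro assms]
  by (intro exI[of _ "1 / 10^8"]) auto

end
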